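(* The pairing of the class $[\mu]$ of the Fredholm module $\mu$ with the class $[p]$ of the projection $p$ is $$\langle[\mu],[p]\rangle:=\langle \mathrm{ch}^0(\mu),\mathrm{ch}_0(p)\rangle=\tau^1(\mathrm{tr}(p))=-1.$$ In particular the right $A(S^4_q)$-module $p[A(S^4_q)^4]$ is not free.
   Context: Fix $q\in\mathbb{R}$ with $0<|q|<1$. $A(S^4_q)$ is the unital complex $*$-algebra generated by $a,\bar a=a^*,b,\bar b=b^*,t=t^*$ with relations $$ab=q^4ba,\quad \bar ab=b\bar a,\quad ta=q^{-2}at,\quad tb=q^4bt$$ together with their conjugates, and $$a\bar a+b\bar b=q^{-2}t(1-q^{-2}t),\quad q^4\bar aa+q^{-4}\bar bb=t(1-t),\quad b\bar b-q^{-4}\bar bb=(1-q^{-4})t^2.$$ The projection $p=p^*=p^2\in M_4(A(S^4_q))$ is $$p=\begin{pmatrix}q^{-2}t&0&a&b\\0&t&q^{-2}\bar b&-q^2\bar a\\ \bar a&q^{-2}b&1-q^{-4}t&0\\ \bar b&-q^2a&0&1-q^2t\end{pmatrix},$$ and $p[A(S^4_q)^4]=\{pF:F\in A(S^4_q)^4\}$ (column vectors), a right $A(S^4_q)$-module. The degree zero Chern character of $p$ is its matrix trace $\mathrm{ch}_0(p)=\mathrm{tr}(p)\in A(S^4_q)$. Let $\beta:A(S^4_q)\to\mathbb{C}$ be the unital character with $\beta(t)=\beta(a)=\beta(b)=0$. Let $\mathcal{H}_\sigma$ be a Hilbert space with orthonormal basis $|m,n\rangle$, $m,n\in\{0,1,2,\dots\}$,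 and let $\sigma$ be the unital $*$-representation of $A(S^4_q)$ on $\mathcal{H}_\sigma$ given by $$\sigma(t)|m,n\rangle=q^{2m+4n+4}|m,n\rangle,$$ $$\sigma(\bar a)|m,n\rangle=(1-q^{2m+2})^{1/2}q^{m+2n+1}|m+1,n\rangle,\quad \sigma(a)|m,n\rangle=(1-q^{2m})^{1/2}q^{m+2n}|m-1,n\rangle,$$ $$\sigma(b)|m,n\rangle=(1-q^{4n+4})^{1/2}q^{2(m+n+2)}|m,n+1\rangle,\quad \sigma(\bar b)|m,n\rangle=(1-q^{4n})^{1/2}q^{2(m+n+1)}|m,n-1\rangle.$$ The $1$-summable Fredholm module $\mu=(\mathcal{H},\Psi,\gamma)$ has $\mathcal{H}=\mathcal{H}_\sigma\oplus\mathcal{H}_\sigma$, representation $\Psi=\sigma\oplus\beta$ (with $\beta$ extended trivially to $\mathcal{H}_\sigma$, i.e. $x$ acts on the second summand as $\beta(x)\,\mathrm{id}$), and grading $\gamma=\mathrm{diag}(1,-1)$. The degree zero component of its Chern character is the trace $\mathrm{ch}^0(\mu)=\tau^1$ on $A(S^4_q)$, $$\tau^1(x):=\mathrm{Tr}(\gamma\Psi(x))=\mathrm{Tr}(\sigma(x)-\beta(x)),$$ the operator $\sigma(x)-\beta(x)$ being always trace class. *)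

theory Defs
  imports
    "HOL-Analysis.Infinite_Sum"
    "HOL-Algebra.QuotRing"
    "HOL-Algebra.Module"
    "HOL-Library.Poly_Mapping"
    "HOL-Library.Nonpos_Ints"
begin

section \<open>The free unital complex *-algebra on \<open>a\<close>, \<open>b\<close> and \<open>t = t*\<close>\<close>

datatype gen = Ga | Gabar | Gb | Gbbar | Gt

fun gen_bar :: "gen \<Rightarrow> gen" where
  "gen_bar Ga = Gabar"
| "gen_bar Gabar = Ga"
| "gen_bar Gb = Gbbar"
| "gen_bar Gbbar = Gb"
| "gen_bar Gt = Gt"

text \<open>Words form a monoid under concatenation, written additively because the convolution product
  of \<^typ>\<open>'a \<Rightarrow>\<^sub>0 'b\<close> expects this; the free algebra is the resulting monoid algebra.\<close>

datatype word = Word (letters: "gen list")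

instantiation word :: monoid_add
begin

definition "0 = Word []"
definition "v + w = Word (letters v @ letters w)"

instance
  by standard (simp_all add: zero_word_def plus_word_def)

end

type_synonym free_alg = "word \<Rightarrow>\<^sub>0 complex"

definition scal :: "complex \<Rightarrow> free_alg" where
  "scal c = Poly_Mapping.single 0 c"

definition letter :: "gen \<Rightarrow> free_alg" where
  "letter g = Poly_Mapping.single (Word [g]) 1"

definition word_bar :: "word \<Rightarrow> word" where
  "word_bar w = Word (rev (map gen_bar (letters w)))"

definition star :: "free_alg \<Rightarrow> free_alg" where
  "star x = (\<Sum>w\<in>Poly_Mapping.keys x.
     Poly_Mapping.single (word_bar w) (cnj (Poly_Mapping.lookup x w)))"

lemma star_letter: "star (letter g) = letter (gen_bar g)"
  by (simp add: star_def letter_def word_bar_def)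

section \<open>The algebra of the quantum 4-sphere\<close>

definition free_ring :: "free_alg ring" where
  "free_ring = \<lparr>carrier = UNIV, mult = (*), one = 1, zero = 0, add = (+)\<rparr>"

definition qpow :: "real \<Rightarrow> int \<Rightarrow> free_alg" where
  "qpow q k = scal (complex_of_real (q powi k))"

text \<open>A relation \<open>l = r\<close> is represented by \<open>l - r\<close>.\<close>

definition basic_relations :: "real \<Rightarrow> free_alg set" where
  "basic_relations q = (let a = letter Ga; a' = letter Gabar; b = letter Gb; b' = letter Gbbar;
     t = letter Gt in
     {a * b - qpow q 4 * (b * a),
      a' * b - b * a',
      t * a - qpow q (-2) * (a * t),
      t * b - qpow q 4 * (b * t),
      (a * a' + b * b') - qpow q (-2) * t * (1 - qpow q (-2) * t),
      (qpow q 4 * (a' * a) + qpow q (-4) * (b' * b)) - t * (1 - t),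
      (b * b' - qpow q (-4) * (b' * b)) - (1 - qpow q (-4)) * t ^ 2})"

definition relations :: "real \<Rightarrow> free_alg set" where
  "relations q = basic_relations q \<union> star ` basic_relations q"

definition rel_ideal :: "real \<Rightarrow> free_alg set" where
  "rel_ideal q = Idl\<^bsub>free_ring\<^esub> (relations q)"

text \<open>The elements of \<open>A(S\<^sup>4\<^sub>q)\<close> are the cosets of the two-sided ideal generated by the relations.\<close>

type_synonym sphere_elem = "free_alg set"

definition qsphere :: "real \<Rightarrow> sphere_elem ring" where
  "qsphere q = free_ring Quot rel_ideal q"

definition cls :: "real \<Rightarrow> free_alg \<Rightarrow> sphere_elem" where
  "cls q x = rel_ideal q +>\<^bsub>free_ring\<^esub> x"

section \<open>The projection and its module\<close>

text \<open>Matrices and column vectors are indexed by \<open>{..<4}\<close>, starting from \<open>0\<close>.\<close>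

definition proj_entries :: "real \<Rightarrow> free_alg list list" where
  "proj_entries q = (let a = letter Ga; a' = letter Gabar; b = letter Gb; b' = letter Gbbar;
     t = letter Gt in
     [[qpow q (-2) * t, 0,               a,                    b],
      [0,               t,               qpow q (-2) * b',     - (qpow q 2 * a')],
      [a',              qpow q (-2) * b, 1 - qpow q (-4) * t,  0],
      [b',              - (qpow q 2 * a), 0,                   1 - qpow q 2 * t]])"

definition qproj :: "real \<Rightarrow> nat \<Rightarrow> nat \<Rightarrow> sphere_elem" where
  "qproj q i j = cls q (proj_entries q ! i ! j)"

definition ch0 :: "real \<Rightarrow> (nat \<Rightarrow> nat \<Rightarrow> sphere_elem) \<Rightarrow> sphere_elem" where
  "ch0 q P = (\<Oplus>\<^bsub>qsphere q\<^esub> i\<in>{..<4}. P i i)"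

definition columns :: "real \<Rightarrow> (nat \<Rightarrow> sphere_elem) set" where
  "columns q = {..<4} \<rightarrow>\<^sub>E carrier (qsphere q)"

definition mat_vec ::
    "real \<Rightarrow> (nat \<Rightarrow> nat \<Rightarrow> sphere_elem) \<Rightarrow> (nat \<Rightarrow> sphere_elem) \<Rightarrow> (nat \<Rightarrow> sphere_elem)" where
  "mat_vec q P F =
     (\<lambda>i\<in>{..<4}. \<Oplus>\<^bsub>qsphere q\<^esub> j\<in>{..<4}. P i j \<otimes>\<^bsub>qsphere q\<^esub> F j)"

text \<open>For right modules, the scalar multiplication field \<open>r \<odot> x\<close> of the module record
  holds \<open>x \<cdot> r\<close>. The ring multiplication fields of that record play no role.\<close>

definition proj_module :: "real \<Rightarrow> (sphere_elem, nat \<Rightarrow> sphere_elem) module" where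
  "proj_module q =
     \<lparr>carrier = mat_vec q (qproj q) ` columns q,
      mult = undefined, one = undefined,
      zero = (\<lambda>i\<in>{..<4}. \<zero>\<^bsub>qsphere q\<^esub>),
      add = (\<lambda>F G. \<lambda>i\<in>{..<4}. F i \<oplus>\<^bsub>qsphere q\<^esub> G i),
      module.smult = (\<lambda>r F. \<lambda>i\<in>{..<4}. F i \<otimes>\<^bsub>qsphere q\<^esub> r)\<rparr>"

definition is_basis ::
    "('r, 'c) ring_scheme \<Rightarrow> ('r, 'm, 'd) module_scheme \<Rightarrow> 'm set \<Rightarrow> bool" where
  "is_basis R M B \<longleftrightarrow> B \<subseteq> carrier M \<and>
     (\<forall>x\<in>carrier M. \<exists>!c. c \<in> B \<rightarrow>\<^sub>E carrier R \<and> finite {v\<in>B. c v \<noteq> \<zero>\<^bsub>R\<^esub>} \<and>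
        x = (\<Oplus>\<^bsub>M\<^esub> v\<in>{v\<in>B. c v \<noteq> \<zero>\<^bsub>R\<^esub>}. c v \<odot>\<^bsub>M\<^esub> v))"

definition free_module ::
    "('r, 'c) ring_scheme \<Rightarrow> ('r, 'm, 'd) module_scheme \<Rightarrow> bool" where
  "free_module R M \<longleftrightarrow> (\<exists>B. is_basis R M B)"

section \<open>The Hilbert space \<open>\<H>\<^sub>\<sigma>\<close> and its trace class operators\<close>

text \<open>\<open>\<H>\<^sub>\<sigma>\<close> is the space of square summable families indexed by the pairs \<open>(m, n)\<close>. Operators are
  functions on all families, of which only the restriction to the Hilbert space matters.\<close>

type_synonym vec = "nat \<times> nat \<Rightarrow> complex"

definition hilb :: "vec set" where
  "hilb = {f. (\<lambda>i. (cmod (f i))\<^sup>2) summable_on UNIV}"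

definition ket :: "nat \<Rightarrow> nat \<Rightarrow> vec" where
  "ket m n = (\<lambda>i. if i = (m, n) then 1 else 0)"

definition inner_prod :: "vec \<Rightarrow> vec \<Rightarrow> complex" where
  "inner_prod f g = (\<Sum>\<^sub>\<infinity>i. cnj (f i) * g i)"

definition hnorm :: "vec \<Rightarrow> real" where
  "hnorm f = sqrt (\<Sum>\<^sub>\<infinity>i. (cmod (f i))\<^sup>2)"

definition bounded_op :: "(vec \<Rightarrow> vec) \<Rightarrow> bool" where
  "bounded_op T \<longleftrightarrow>
     (\<forall>f\<in>hilb. T f \<in> hilb) \<and>
     (\<forall>f\<in>hilb. \<forall>g\<in>hilb. T (\<lambda>i. f i + g i) = (\<lambda>i. T f i + T g i)) \<and>
     (\<forall>c. \<forall>f\<in>hilb. T (\<lambda>i. c * f i) = (\<lambda>i. c * T f i)) \<and>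
     (\<exists>K. \<forall>f\<in>hilb. hnorm (T f) \<le> K * hnorm f)"

text \<open>\<open>S = |T|\<close>: the positive operator with \<open>S\<^sup>2 = T\<^sup>* T\<close>, the latter written weakly.\<close>

definition is_abs_op :: "(vec \<Rightarrow> vec) \<Rightarrow> (vec \<Rightarrow> vec) \<Rightarrow> bool" where
  "is_abs_op T S \<longleftrightarrow> bounded_op S \<and>
     (\<forall>f\<in>hilb. inner_prod f (S f) \<in> \<real>\<^sub>\<ge>\<^sub>0) \<and>
     (\<forall>f\<in>hilb. \<forall>g\<in>hilb. inner_prod (S f) (S g) = inner_prod (T f) (T g))"

definition trace_class :: "(vec \<Rightarrow> vec) \<Rightarrow> bool" where
  "trace_class T \<longleftrightarrow> bounded_op T \<and>
     (\<exists>S. is_abs_op T S \<and>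
        (\<lambda>(m, n). inner_prod (ket m n) (S (ket m n))) summable_on UNIV)"

definition op_trace :: "(vec \<Rightarrow> vec) \<Rightarrow> complex" where
  "op_trace T =
     (if trace_class T then \<Sum>\<^sub>\<infinity>(m, n). inner_prod (ket m n) (T (ket m n)) else 0)"

section \<open>The Fredholm module\<close>

text \<open>The generators act by weighted shifts; the definition gives the \<open>(m, n)\<close> coefficient of the
  image. Their action on the basis vectors is spelled out in \<open>gen_op_ket\<close>. Where \<open>m - 1\<close> or \<open>n - 1\<close>
  is truncated, the square root vanishes.\<close>

fun gen_op :: "real \<Rightarrow> gen \<Rightarrow> vec \<Rightarrow> vec" where
  "gen_op q Gt f = (\<lambda>(m, n). complex_of_real (q ^ (2*m + 4*n + 4)) * f (m, n))"
| "gen_op q Gabar f =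
     (\<lambda>(m, n). complex_of_real (sqrt (1 - q ^ (2*m)) * q ^ (m + 2*n)) * f (m - 1, n))"
| "gen_op q Ga f =
     (\<lambda>(m, n). complex_of_real (sqrt (1 - q ^ (2*m + 2)) * q ^ (m + 2*n + 1)) * f (m + 1, n))"
| "gen_op q Gb f =
     (\<lambda>(m, n). complex_of_real (sqrt (1 - q ^ (4*n)) * q ^ (2*(m + n + 1))) * f (m, n - 1))"
| "gen_op q Gbbar f =
     (\<lambda>(m, n). complex_of_real (sqrt (1 - q ^ (4*n + 4)) * q ^ (2*(m + n + 2))) * f (m, n + 1))"

lemma gen_op_ket:
  "gen_op q Gt (ket m n) = (\<lambda>i. complex_of_real (q ^ (2*m + 4*n + 4)) * ket m n i)"
  "gen_op q Gabar (ket m n) =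
     (\<lambda>i. complex_of_real (sqrt (1 - q ^ (2*m + 2)) * q ^ (m + 2*n + 1)) * ket (m + 1) n i)"
  "gen_op q Ga (ket m n) =
     (\<lambda>i. complex_of_real (sqrt (1 - q ^ (2*m)) * q ^ (m + 2*n)) * ket (m - 1) n i)"
  "gen_op q Gb (ket m n) =
     (\<lambda>i. complex_of_real (sqrt (1 - q ^ (4*n + 4)) * q ^ (2*(m + n + 2))) * ket m (n + 1) i)"
  "gen_op q Gbbar (ket m n) =
     (\<lambda>i. complex_of_real (sqrt (1 - q ^ (4*n)) * q ^ (2*(m + n + 1))) * ket m (n - 1) i)"
proof -
  show
    "gen_op q Gt (ket m n) = (\<lambda>i. complex_of_real (q ^ (2*m + 4*n + 4)) * ket m n i)"
    by (rule ext) (auto simp: ket_def split: if_splits)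
  show
    "gen_op q Gabar (ket m n) =
       (\<lambda>i. complex_of_real (sqrt (1 - q ^ (2*m + 2)) * q ^ (m + 2*n + 1)) * ket (m + 1) n i)"
    proof (rule ext, goal_cases)
    case (1 i)
    obtain k l where "i = (k, l)" by (cases i)
    then show ?case by (cases k) (auto simp: ket_def split: if_splits)
  qed
  show
    "gen_op q Ga (ket m n) =
       (\<lambda>i. complex_of_real (sqrt (1 - q ^ (2*m)) * q ^ (m + 2*n)) * ket (m - 1) n i)"
    by (cases m) (auto simp: ket_def fun_eq_iff split: if_splits)
  show
    "gen_op q Gb (ket m n) =
       (\<lambda>i. complex_of_real (sqrt (1 - q ^ (4*n + 4)) * q ^ (2*(m + n + 2))) * ket m (n + 1) i)"
    proof (rule ext, goal_cases)
    case (1 i)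
    obtain k l where "i = (k, l)" by (cases i)
    then show ?case by (cases l) (auto simp: ket_def add.commute split: if_splits)
  qed
  show
    "gen_op q Gbbar (ket m n) =
       (\<lambda>i. complex_of_real (sqrt (1 - q ^ (4*n)) * q ^ (2*(m + n + 1))) * ket m (n - 1) i)"
    by (cases n) (auto simp: ket_def fun_eq_iff add.commute split: if_splits)
qed

definition word_op :: "real \<Rightarrow> word \<Rightarrow> vec \<Rightarrow> vec" where
  "word_op q w = foldr (gen_op q) (letters w)"

definition free_rep :: "real \<Rightarrow> free_alg \<Rightarrow> vec \<Rightarrow> vec" where
  "free_rep q x f = (\<lambda>i. \<Sum>w\<in>Poly_Mapping.keys x. Poly_Mapping.lookup x w * word_op q w f i)"

text \<open>The character sends all five generators to \<open>0\<close> and hence reads off the constant term.\<close>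

definition free_char :: "free_alg \<Rightarrow> complex" where
  "free_char x = (\<Sum>w\<in>Poly_Mapping.keys x.
     Poly_Mapping.lookup x w * prod_list (map (\<lambda>g. 0) (letters w)))"

definition sigma :: "real \<Rightarrow> sphere_elem \<Rightarrow> vec \<Rightarrow> vec" where
  "sigma q c = the_elem (free_rep q ` c)"

definition beta :: "sphere_elem \<Rightarrow> complex" where
  "beta c = the_elem (free_char ` c)"

text \<open>Both maps vanish on the relations, so \<open>sigma\<close> and \<open>beta\<close> are well defined on cosets; this is
  the content of \<open>sigma_cls\<close> and \<open>beta_cls\<close>.\<close>

lemma monomials:
  "x = (\<Sum>w\<in>Poly_Mapping.keys x. Poly_Mapping.single w (Poly_Mapping.lookup x w))"
  by (rule poly_mapping_eqI) (simp add: lookup_sum lookup_single when_def in_keys_iff)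

lemma free_rep_superset:
  assumes "finite A" "Poly_Mapping.keys x \<subseteq> A"
  shows "free_rep q x f i = (\<Sum>w\<in>A. Poly_Mapping.lookup x w * word_op q w f i)"
  unfolding free_rep_def using assms by (intro sum.mono_neutral_left) (auto simp: in_keys_iff)

lemma free_rep_single: "free_rep q (Poly_Mapping.single w c) f = (\<lambda>i. c * word_op q w f i)"
  by (rule ext, subst free_rep_superset[of "{w}"]) auto

lemma free_rep_add: "free_rep q (x + y) f i = free_rep q x f i + free_rep q y f i"
proof -
  let ?A = "Poly_Mapping.keys x \<union> Poly_Mapping.keys y"
  have "Poly_Mapping.keys (x + y) \<subseteq> ?A" by (rule Poly_Mapping.keys_add)
  then show ?thesis
    by (simp add: free_rep_superset[of ?A] lookup_add sum.distrib ring_distribs)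
qed

lemma free_rep_zero: "free_rep q 0 f i = 0" by (simp add: free_rep_def)

lemma free_rep_sum: "free_rep q (sum g A) f i = (\<Sum>a\<in>A. free_rep q (g a) f i)"
  by (induction A rule: infinite_finite_induct) (auto simp: free_rep_add free_rep_zero)

lemma free_rep_diff: "free_rep q (x - y) f i = free_rep q x f i - free_rep q y f i"
  using free_rep_add[of q "x-y" y f i] by simp

lemma gen_op_lin:
  "gen_op q g (\<lambda>i. \<Sum>a\<in>A. c a * F a i) =
    (\<lambda>i. \<Sum>a\<in>A. c a * gen_op q g (F a) i)"
  by (cases g) (auto simp: fun_eq_iff sum_distrib_left intro!: sum.cong)

lemma word_op_lin:
  "word_op q w (\<lambda>i. \<Sum>a\<in>A. c a * F a i) =
    (\<lambda>i. \<Sum>a\<in>A. c a * word_op q w (F a) i)"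
proof -
  have "foldr (gen_op q) l (\<lambda>i. \<Sum>a\<in>A. c a * F a i) =
    (\<lambda>i. \<Sum>a\<in>A. c a * foldr (gen_op q) l (F a) i)" for l
    by (induction l) (simp_all add: gen_op_lin)
  then show ?thesis by (simp add: word_op_def)
qed

lemma word_op_plus: "word_op q (v + w) f = word_op q v (word_op q w f)"
  by (simp add: word_op_def plus_word_def)

lemma free_rep_mult: "free_rep q (x * y) f = free_rep q x (free_rep q y f)"
proof
  fix i
  have "free_rep q (x * y) f i = free_rep q
      ((\<Sum>w\<in>Poly_Mapping.keys x. Poly_Mapping.single w (Poly_Mapping.lookup x w)) *
       (\<Sum>w\<in>Poly_Mapping.keys y. Poly_Mapping.single w (Poly_Mapping.lookup y w))) f i"
    using monomials[of x] monomials[of y] by simp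
  also have "\<dots> = free_rep q x (free_rep q y f) i"
    by (simp add: sum_product mult_single free_rep_sum free_rep_single word_op_plus)
       (simp add: free_rep_def word_op_lin sum_distrib_left mult.assoc)
  finally show "free_rep q (x * y) f i = free_rep q x (free_rep q y f) i" .
qed

lemma free_rep_zero_vec: "free_rep q x (\<lambda>_. 0) = (\<lambda>_. 0)"
  using word_op_lin[where A="{}"] by (simp add: free_rep_def)

lemma ring_free_ring: "ring free_ring"
  apply unfold_locales
  apply (auto simp: free_ring_def Units_def algebra_simps)
  subgoal for x by (rule exI[of _ "- x"]) simp
  done

lemma ker_ideal: "ideal {x. \<forall>f. free_rep q x f = (\<lambda>_. 0)} free_ring"
proof -
  have 0: "free_rep q (- x) f = (\<lambda>_. 0)" if "free_rep q x f = (\<lambda>_. 0)" for x f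
    using free_rep_diff[of q 0 x f] that by (auto simp: free_rep_zero)
  interpret ring "free_ring :: free_alg ring" by (rule ring_free_ring)
  have inv: "a_inv free_ring (x :: free_alg) = - x" for x
    by (rule minus_equality) (auto simp: free_ring_def)
  have zv: "free_rep q x (\<lambda>_. 0) = (\<lambda>_. 0)" for x by (rule free_rep_zero_vec)
  let ?K = "{x. \<forall>f. free_rep q x f = (\<lambda>_. 0)}"
  have sg: "subgroup ?K (add_monoid free_ring)"
  proof (rule add.subgroupI)
    show "?K \<noteq> {}" using free_rep_zero[of q] by (auto simp: fun_eq_iff intro!: exI[of _ 0])
    show "\<ominus>\<^bsub>free_ring\<^esub> a \<in> ?K" if "a \<in> ?K" for a
      using that 0[of a] by (simp only: inv mem_Collect_eq) blast
  qed (auto simp: free_ring_def free_rep_add fun_eq_iff)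
  show ?thesis
  proof (rule idealI[OF ring_free_ring sg])
    fix a x assume a: "a \<in> ?K"
    show "x \<otimes>\<^bsub>free_ring\<^esub> a \<in> ?K" using a by (simp add: free_ring_def free_rep_mult zv)
    show "a \<otimes>\<^bsub>free_ring\<^esub> x \<in> ?K" using a by (simp add: free_ring_def free_rep_mult)
  qed
qed

lemma star_superset:
  assumes "finite A" "Poly_Mapping.keys x \<subseteq> A"
  shows "star x = (\<Sum>w\<in>A. Poly_Mapping.single (word_bar w) (cnj (Poly_Mapping.lookup x w)))"
  unfolding star_def using assms by (intro sum.mono_neutral_left) (auto simp: in_keys_iff)

lemma star_single: "star (Poly_Mapping.single w c) = Poly_Mapping.single (word_bar w) (cnj c)"
  by (subst star_superset[of "{w}"]) auto

lemma star_add: "star (x + y) = star x + star y"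
proof -
  let ?A = "Poly_Mapping.keys x \<union> Poly_Mapping.keys y"
  have "Poly_Mapping.keys (x + y) \<subseteq> ?A" by (rule Poly_Mapping.keys_add)
  then show ?thesis
    by (simp add: star_superset[of ?A] lookup_add sum.distrib single_add)
qed

lemma star_zero: "star 0 = 0" by (simp add: star_def)
lemma star_sum: "star (sum g A) = (\<Sum>a\<in>A. star (g a))"
  by (induction A rule: infinite_finite_induct) (auto simp: star_add star_zero)
lemma star_diff: "star (x - y) = star x - star y"
  using star_add[of "x-y" y] by simp

lemma word_bar_plus: "word_bar (v + w) = word_bar w + word_bar v"
  by (simp add: word_bar_def plus_word_def)

lemma star_mult: "star (x * y) = star y * star x"
proof -
  have "star (x * y) = star
      ((\<Sum>w\<in>Poly_Mapping.keys x. Poly_Mapping.single w (Poly_Mapping.lookup x w)) *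
       (\<Sum>w\<in>Poly_Mapping.keys y. Poly_Mapping.single w (Poly_Mapping.lookup y w)))"
    using monomials[of x] monomials[of y] by simp
  also have "\<dots> = star y * star x"
    by (simp add: sum_product mult_single star_sum star_single word_bar_plus)
       (simp add: star_def sum_product mult_single mult.commute sum.swap[of _ "Poly_Mapping.keys x"])
  finally show ?thesis .
qed

lemma star_qpow: "star (qpow q k) = qpow q k"
  by (simp add: qpow_def scal_def star_single word_bar_def zero_word_def)

lemma one_scal: "1 = scal 1" by (simp add: scal_def)

lemma star_one: "star 1 = 1"
  by (simp add: one_scal) (simp add: scal_def star_single word_bar_def zero_word_def)

lemma fr_letter: "free_rep q (letter g) f = gen_op q g f"
  by (simp add: letter_def free_rep_single word_op_def)

lemma fr_scal: "free_rep q (scal c) f = (\<lambda>i. c * f i)"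
  by (simp add: scal_def free_rep_single word_op_def zero_word_def)

lemma fr_qpow: "free_rep q (qpow q k) f = (\<lambda>i. complex_of_real (q powi k) * f i)"
  by (simp add: qpow_def fr_scal)

lemma fr_one: "free_rep q 1 f = f"
  by (simp add: one_scal fr_scal)

lemma sq_aux: assumes "\<bar>q\<bar> < (1::real)" "even k"
  shows "complex_of_real (sqrt (1 - q^k)) * complex_of_real (sqrt (1 - q^k)) =
    1 - complex_of_real q ^ k"
proof -
  have "q ^ k \<le> 1" using assms power_le_one[of "\<bar>q\<bar>" k] by (simp add: power_even_abs)
  then show ?thesis by (simp flip: of_real_mult of_real_power)
qed

lemmas fr = free_rep_diff free_rep_add free_rep_mult fr_letter fr_qpow fr_one
lemmas st = star_diff star_add star_mult star_letter star_qpow star_one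

lemma sq_aux2: assumes "\<bar>q\<bar> < (1::real)" "even k"
  shows "complex_of_real (sqrt (1 - q^k)) * (complex_of_real (sqrt (1 - q^k)) * z) =
    (1 - complex_of_real q ^ k) * z"
  by (simp flip: sq_aux[OF assms] add: mult.assoc)

lemma pow2: "x ^ (2*k) = x ^ k * (x::complex) ^ k" by (simp add: mult_2 power_add)
lemma pow4: "x ^ (4*k) = x ^ k * x ^ k * (x ^ k * (x::complex) ^ k)"
  using pow2[of x "2*k"] pow2[of x k] by simp

lemma rel_zero: 
  assumes q: "0 < \<bar>q\<bar>" "\<bar>q\<bar> < 1"
  shows "x \<in> relations q \<Longrightarrow> free_rep q x f (m, n) = 0"
proof -
  define Q where "Q = complex_of_real q"
  define A where "A k = complex_of_real (sqrt (1 - q ^ (2*k)))" for k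
  define B where "B k = complex_of_real (sqrt (1 - q ^ (4*k)))" for k
  have q0: "Q \<noteq> 0" using q by (auto simp: Q_def)
  define V where "V = inverse Q"
  have V: "Q * V = 1" "V * Q = 1" "Q * (V * z) = z" "V * (Q * z) = z" for z
    using q0 by (auto simp: V_def)
  have pw:
    "complex_of_real (q powi (-2)) = V * V"
    "complex_of_real (q powi (-4)) = V * V * V * V"
    "complex_of_real (q powi 4) = Q * Q * Q * Q"
    "complex_of_real (q powi 2) = Q * Q"
    by (auto simp: power_int_def Q_def V_def power2_eq_square power4_eq_xxxx power_inverse)
  have AA: "A k * A k = 1 - Q^k * Q^k" "A k * (A k * z) = (1 - Q^k * Q^k) * z" for k z
    using sq_aux[OF q(2), of "2*k"] by (auto simp: A_def Q_def pow2 simp flip: mult.assoc)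
  have BB: "B k * B k = 1 - Q^k * Q^k * (Q^k * Q^k)"
    "B k * (B k * z) = (1 - Q^k * Q^k * (Q^k * Q^k)) * z" for k z
    using sq_aux[OF q(2), of "4*k"] by (auto simp: B_def Q_def pow4 simp flip: mult.assoc)
  have 0: "A 0 = 0" "B 0 = 0" by (auto simp: A_def B_def)
  have g: "gen_op q Gt f (m, n) = Q ^ (2*m + 4*n + 4) * f (m, n)"
   "gen_op q Gabar f (m, n) = A m * Q ^ (m + 2*n) * f (m - 1, n)"
   "gen_op q Ga f (m, n) = A (Suc m) * Q ^ (m + 2*n + 1) * f (Suc m, n)"
   "gen_op q Gb f (m, n) = B n * Q ^ (2*(m + n + 1)) * f (m, n - 1)"
   "gen_op q Gbbar f (m, n) = B (Suc n) * Q ^ (2*(m + n + 2)) * f (m, Suc n)" for m n f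
    by (simp_all add: A_def B_def Q_def add.commute del: mult_Suc_right power_Suc)
       (simp_all add: add.commute)?
  have "\<forall>x\<in>relations q. free_rep q x f (m, n) = 0"
    unfolding relations_def basic_relations_def Let_def
    apply (simp only: ball_Un image_insert image_empty ball_simps st gen_bar.simps simp_thms
        power2_eq_square)
    apply (simp only: fr g pw split: prod.split)
    apply (cases m; cases n)
    apply (simp_all only: power_add pow2 pow4 power2_eq_square power4_eq_xxxx 0
        diff_Suc_1 diff_0_eq_0 power_Suc power_0)
    apply (simp_all add: algebra_simps V AA BB power4_eq_xxxx)
    done
  then show "x \<in> relations q \<Longrightarrow> free_rep q x f (m, n) = 0" by blast
qed

lemma rel_ker: assumes q: "0 < \<bar>q\<bar>" "\<bar>q\<bar> < 1"
  shows "rel_ideal q \<subseteq> {x. \<forall>f. free_rep q x f = (\<lambda>_. 0)}"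
  unfolding rel_ideal_def genideal_def using ker_ideal[of q] rel_zero[OF q] 
  by (intro Inter_lower) (auto simp: fun_eq_iff)

lemma sigma_cls: assumes q: "0 < \<bar>q\<bar>" "\<bar>q\<bar> < 1"
  shows "sigma q (cls q x) = free_rep q x"
proof -
  interpret ring free_ring by (rule ring_free_ring)
  have id: "ideal (rel_ideal q) free_ring"
    unfolding rel_ideal_def by (rule genideal_ideal) (simp add: free_ring_def)
  have "free_rep q (h + x) = free_rep q x" if "h \<in> rel_ideal q" for h
    using rel_ker[OF q] that by (auto simp: fun_eq_iff free_rep_add)
  moreover have "0 \<in> rel_ideal q"
    using additive_subgroup.zero_closed[OF ideal.axioms(1)[OF id]] by (simp add: free_ring_def)
  ultimately have "free_rep q ` cls q x = {free_rep q x}"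
    unfolding cls_def a_r_coset_def r_coset_def by (force simp: free_ring_def)
  then show ?thesis by (simp add: sigma_def)
qed

lemma free_char_superset:
  assumes "finite A" "Poly_Mapping.keys x \<subseteq> A"
  shows "free_char x =
    (\<Sum>w\<in>A. Poly_Mapping.lookup x w * prod_list (map (\<lambda>g. 0) (letters w)))"
  unfolding free_char_def using assms by (intro sum.mono_neutral_left) (auto simp: in_keys_iff)

lemma free_char_single:
  "free_char (Poly_Mapping.single w c) = c * prod_list (map (\<lambda>g. 0) (letters w))"
  by (subst free_char_superset[of "{w}"]) auto

lemma free_char_zero: "free_char 0 = 0"
  by (simp add: free_char_def)

lemma free_char_add: "free_char (x + y) = free_char x + free_char y"
proof -
  let ?A = "Poly_Mapping.keys x \<union> Poly_Mapping.keys y"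
  have "Poly_Mapping.keys (x + y) \<subseteq> ?A" by (rule Poly_Mapping.keys_add)
  then show ?thesis
    by (simp add: free_char_superset[of ?A] lookup_add sum.distrib ring_distribs)
qed

lemma free_char_sum: "free_char (sum g A) = (\<Sum>a\<in>A. free_char (g a))"
  by (induction A rule: infinite_finite_induct) (auto simp: free_char_add free_char_zero)

lemma free_char_diff: "free_char (x - y) = free_char x - free_char y"
  using free_char_add[of "x - y" y] by simp

lemma free_char_mult: "free_char (x * y) = free_char x * free_char y"
proof -
  have "free_char (x * y) = free_char
      ((\<Sum>w\<in>Poly_Mapping.keys x. Poly_Mapping.single w (Poly_Mapping.lookup x w)) *
       (\<Sum>w\<in>Poly_Mapping.keys y. Poly_Mapping.single w (Poly_Mapping.lookup y w)))"
    using monomials[of x] monomials[of y] by simp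
  also have "\<dots> = free_char x * free_char y"
    by (simp add: sum_product mult_single free_char_sum free_char_single plus_word_def)
       (simp add: free_char_def sum_product mult_ac)
  finally show ?thesis .
qed

lemma free_char_letter: "free_char (letter g) = 0"
  by (simp add: letter_def free_char_single)

lemma free_char_ker_ideal: "ideal {x. free_char x = 0} free_ring"
proof -
  interpret ring free_ring by (rule ring_free_ring)
  have inv: "a_inv free_ring (x :: free_alg) = - x" for x
    by (rule minus_equality) (auto simp: free_ring_def)
  have neg: "free_char (- x) = - free_char x" for x
    using free_char_diff[of 0 x] by (simp add: free_char_zero)
  have sg: "subgroup {x. free_char x = 0} (add_monoid free_ring)"
  proof (rule add.subgroupI)
    show "{x. free_char x = 0} \<noteq> {}" using free_char_zero by auto
    show "\<ominus>\<^bsub>free_ring\<^esub> a \<in> {x. free_char x = 0}" if "a \<in> {x. free_char x = 0}" for a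
      using that by (simp add: inv neg)
  qed (auto simp: free_ring_def free_char_add)
  show ?thesis
    by (rule idealI[OF ring_free_ring sg]) (auto simp: free_ring_def free_char_mult)
qed

lemma free_char_relations: "x \<in> relations q \<Longrightarrow> free_char x = 0"
proof -
  have "\<forall>x\<in>relations q. free_char x = 0"
    unfolding relations_def basic_relations_def Let_def
    by (simp only: ball_Un image_insert image_empty ball_simps st gen_bar.simps simp_thms
          power2_eq_square free_char_diff free_char_add free_char_mult free_char_letter
          mult_zero_left mult_zero_right add_0_left diff_self)
  then show "x \<in> relations q \<Longrightarrow> free_char x = 0" by blast
qed

lemma beta_cls: "beta (cls q x) = free_char x"
proof -
  interpret ring free_ring by (rule ring_free_ring)
  have id: "ideal (rel_ideal q) free_ring"
    unfolding rel_ideal_def by (rule genideal_ideal) (simp add: free_ring_def)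
  have ker: "rel_ideal q \<subseteq> {x. free_char x = 0}"
    unfolding rel_ideal_def genideal_def using free_char_ker_ideal free_char_relations
    by (intro Inter_lower) auto
  have "free_char (h + x) = free_char x" if "h \<in> rel_ideal q" for h
    using ker that by (auto simp: free_char_add)
  moreover have "0 \<in> rel_ideal q"
    using additive_subgroup.zero_closed[OF ideal.axioms(1)[OF id]] by (simp add: free_ring_def)
  ultimately have "free_char ` cls q x = {free_char x}"
    unfolding cls_def a_r_coset_def r_coset_def by (force simp: free_ring_def)
  then show ?thesis by (simp add: beta_def)
qed

text \<open>The representation on \<open>\<H>\<^sub>\<sigma> \<oplus> \<H>\<^sub>\<sigma>\<close> and the grading.\<close>

definition Psi :: "real \<Rightarrow> sphere_elem \<Rightarrow> vec \<times> vec \<Rightarrow> vec \<times> vec" where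
  "Psi q x = (\<lambda>(u, v). (sigma q x u, \<lambda>i. beta x * v i))"

definition grading :: "vec \<times> vec \<Rightarrow> vec \<times> vec" where
  "grading = (\<lambda>(u, v). (u, \<lambda>i. - v i))"

text \<open>The operator \<open>\<gamma>\<Psi>(x)\<close> is block diagonal and in general not trace class on the direct sum (take
  \<open>x = 1\<close>), so \<open>Tr(\<gamma>\<Psi>(x))\<close> is the trace over \<open>\<H>\<^sub>\<sigma>\<close> of the sum of its two diagonal blocks.\<close>

definition tau1 :: "real \<Rightarrow> sphere_elem \<Rightarrow> complex" where
  "tau1 q x = op_trace (\<lambda>f i.
     fst (grading (Psi q x (f, \<lambda>_. 0))) i + snd (grading (Psi q x (\<lambda>_. 0, f))) i)"

lemma tau1_eq: "tau1 q x = op_trace (\<lambda>f i. sigma q x f i - beta x * f i)"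
  by (simp add: tau1_def grading_def Psi_def)

definition chern_pairing :: "real \<Rightarrow> (nat \<Rightarrow> nat \<Rightarrow> sphere_elem) \<Rightarrow> complex" where
  "chern_pairing q P = tau1 q (ch0 q P)"

end

theory Submission
  imports Defs
begin

text \<open>The pairing is a computation. The matrix trace of \<open>p\<close> is \<open>2 - q\<^sup>-\<^sup>4 (1 - q\<^sup>2) (1 - q\<^sup>4) t\<close>, so \<open>\<sigma> - \<beta>\<close> sends
  it to a diagonal operator whose entries form a double geometric series with sum \<open>-1\<close>
  (\<open>has_sum_proj_trace\<close>), and the trace of an absolutely summable diagonal operator is the sum of its
  entries (\<open>op_trace_diagonal\<close>).

  The pairing detects that the module is not free because \<open>\<tau>\<^sup>1\<close> is a trace with \<open>\<tau>\<^sup>1(1) = 0\<close>. If \<open>p[A\<^sup>4]\<close>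
  were free, then \<open>p = u w\<close> and \<open>w u = 1\<close> for rectangular matrices over \<open>A\<close>, which come from the elements of a
  basis and the coefficients of the columns of \<open>p\<close> in it (\<open>basis_factorization\<close>). Every trace then takes the value
  \<open>n \<tau>(1)\<close> on \<open>tr(p)\<close>, where \<open>n\<close> is the size of \<open>w u\<close> (\<open>trace_of_free\<close>); for \<open>\<tau>\<^sup>1\<close> this is \<open>0\<close> and not \<open>-1\<close>.
  The argument needs \<open>p\<^sup>2 = p\<close>, which is checked on the level of the relations (\<open>proj_entries_idempotent\<close>).

  The trace property is proved without the theory of trace class operators. Words in the generators are
  weighted composition operators on families indexed by pairs of natural numbers, so their diagonal
  coefficients are weights of closed paths in the lattice, and these do not depend on the base point
  (\<open>reg_trace_word_commute\<close>). Geometric decay of the weights of nonempty words makes all the sums converge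
  (\<open>path_weight_le\<close>), which allows extending the trace property to linear combinations.\<close>

section \<open>Words as weighted composition operators\<close>

text \<open>Every generator acts as a weighted composition operator: its \<open>i\<close>-th coefficient is a weight
  at \<open>i\<close> times the value of the vector at a neighbouring index. Where \<open>step\<close> truncates at the border
  of the lattice the weight vanishes.\<close>

fun step :: "gen \<Rightarrow> nat \<times> nat \<Rightarrow> nat \<times> nat" where
  "step Gt (m, n) = (m, n)"
| "step Gabar (m, n) = (m - 1, n)"
| "step Ga (m, n) = (m + 1, n)"
| "step Gb (m, n) = (m, n - 1)"
| "step Gbbar (m, n) = (m, n + 1)"

fun weight :: "real \<Rightarrow> gen \<Rightarrow> nat \<times> nat \<Rightarrow> real" where
  "weight q Gt (m, n) = q ^ (2*m + 4*n + 4)"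
| "weight q Gabar (m, n) = sqrt (1 - q ^ (2*m)) * q ^ (m + 2*n)"
| "weight q Ga (m, n) = sqrt (1 - q ^ (2*m + 2)) * q ^ (m + 2*n + 1)"
| "weight q Gb (m, n) = sqrt (1 - q ^ (4*n)) * q ^ (2*(m + n + 1))"
| "weight q Gbbar (m, n) = sqrt (1 - q ^ (4*n + 4)) * q ^ (2*(m + n + 2))"

text \<open>A word is again a weighted composition operator. The leftmost letter is applied last, hence it is the
  first one met when the value of the image at \<open>i\<close> is traced back to a value of the argument.\<close>

fun path :: "gen list \<Rightarrow> nat \<times> nat \<Rightarrow> nat \<times> nat" where
  "path [] i = i"
| "path (g # l) i = path l (step g i)"

fun path_weight :: "real \<Rightarrow> gen list \<Rightarrow> nat \<times> nat \<Rightarrow> real" where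
  "path_weight q [] i = 1"
| "path_weight q (g # l) i = weight q g i * path_weight q l (step g i)"

lemma gen_op_weight: "gen_op q g f i = complex_of_real (weight q g i) * f (step g i)"
  by (cases g; cases i) auto

lemma foldr_gen_op:
  "foldr (gen_op q) l f i = complex_of_real (path_weight q l i) * f (path l i)"
  by (induction l arbitrary: i) (simp_all add: gen_op_weight)

lemma path_append: "path (v @ w) i = path w (path v i)"
  by (induction v arbitrary: i) auto

lemma path_weight_append: "path_weight q (v @ w) i = path_weight q v i * path_weight q w (path v i)"
  by (induction v arbitrary: i) auto

lemma sqrt_power_le:
  fixes q :: real
  assumes "\<bar>q\<bar> < 1" "even k" "j \<le> l"
  shows "\<bar>sqrt (1 - q ^ k) * q ^ l\<bar> \<le> \<bar>q\<bar> ^ j"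
proof -
  have "0 \<le> q ^ k" "q ^ k \<le> 1"
    using assms power_le_one[of "\<bar>q\<bar>" k] by (auto simp: power_even_abs zero_le_even_power)
  then have "\<bar>sqrt (1 - q ^ k)\<bar> \<le> 1" by simp
  moreover have "\<bar>q\<bar> ^ l \<le> \<bar>q\<bar> ^ j"
    using assms by (intro power_decreasing) auto
  ultimately show ?thesis
    using mult_mono[of "\<bar>sqrt (1 - q ^ k)\<bar>" 1 "\<bar>q\<bar> ^ l" "\<bar>q\<bar> ^ j"]
    by (simp add: abs_mult power_abs)
qed

text \<open>The decay in both directions comes with every generator. Since all weights are at most \<open>1\<close>, one letter
  is enough to make every nonempty word decay geometrically.\<close>

lemma weight_le:
  assumes "\<bar>q\<bar> < 1"
  shows "\<bar>weight q g (m, n)\<bar> \<le> \<bar>q\<bar> ^ (m + n)"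
proof (cases g)
  case Gt
  then show ?thesis
    using power_decreasing[of "m + n" "2*m + 4*n + 4" "\<bar>q\<bar>"] assms
    by (simp add: power_abs)
qed (simp_all only: weight.simps, (rule sqrt_power_le; use assms in simp)+)

lemma path_weight_le_1:
  assumes "\<bar>q\<bar> < 1"
  shows "\<bar>path_weight q l i\<bar> \<le> 1"
proof (induction l arbitrary: i)
  case (Cons g l)
  have "\<bar>weight q g i\<bar> \<le> 1"
    using weight_le[OF assms, of g "fst i" "snd i"] power_le_one[of "\<bar>q\<bar>" "fst i + snd i"] assms
    by simp
  with Cons show ?case by (simp add: abs_mult mult_le_one)
qed auto

lemma path_weight_le:
  assumes "\<bar>q\<bar> < 1" "l \<noteq> []"
  shows "\<bar>path_weight q l (m, n)\<bar> \<le> \<bar>q\<bar> ^ (m + n)"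
proof -
  obtain g k where "l = g # k" using assms(2) by (cases l) auto
  then show ?thesis
    using mult_mono[OF weight_le[OF assms(1), of g m n] path_weight_le_1[OF assms(1), of k "step g (m, n)"]]
    by (simp add: abs_mult)
qed

section \<open>Double geometric series\<close>

lemma has_sum_geometric:
  fixes x :: real
  assumes "0 \<le> x" "x < 1"
  shows "((\<lambda>n. x ^ n) has_sum (1 / (1 - x))) UNIV"
  using assms by (intro sums_nonneg_imp_has_sum geometric_sums) auto

lemma has_sum_geometric_pair:
  fixes x y :: real
  assumes "0 \<le> x" "x < 1" "0 \<le> y" "y < 1"
  shows "((\<lambda>(m, n). x ^ m * y ^ n) has_sum (1 / ((1 - x) * (1 - y)))) UNIV"
proof -
  have 1: "((\<lambda>n. x ^ m * y ^ n) has_sum (x ^ m * (1 / (1 - y)))) UNIV" for m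
    using assms by (intro has_sum_cmult_right has_sum_geometric) auto
  have 2: "((\<lambda>m. x ^ m * (1 / (1 - y))) has_sum (1 / (1 - x) * (1 / (1 - y)))) UNIV"
    using assms by (intro has_sum_cmult_left has_sum_geometric) auto
  have "(\<lambda>(m, n). x ^ m * y ^ n) summable_on (UNIV \<times> UNIV)"
    using assms by (intro summable_on_SigmaI[where g = "\<lambda>m. x ^ m * (1 / (1 - y))"])
      (use 1 2 in \<open>auto simp: summable_on_def\<close>)
  then obtain S where S: "((\<lambda>(m, n). x ^ m * y ^ n) has_sum S) (UNIV \<times> UNIV)"
    by (auto simp: summable_on_def)
  then have "((\<lambda>m. x ^ m * (1 / (1 - y))) has_sum S) UNIV"
    by (rule has_sum_Sigma') (use 1 in auto)
  with 2 have "S = 1 / (1 - x) * (1 / (1 - y))" by (rule has_sum_unique[rotated])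
  with S show ?thesis by simp
qed

section \<open>The trace by its matrix coefficients\<close>

definition diag_entry :: "real \<Rightarrow> free_alg \<Rightarrow> nat \<times> nat \<Rightarrow> complex" where
  "diag_entry q x i = free_rep q x (ket (fst i) (snd i)) i - free_char x"

text \<open>The functional \<open>\<tau>\<^sup>1\<close>, pulled back to the free algebra and written as a plain sum, which can be computed word
  by word.\<close>

definition reg_trace :: "real \<Rightarrow> free_alg \<Rightarrow> complex" where
  "reg_trace q x = (\<Sum>\<^sub>\<infinity>i. diag_entry q x i)"

lemma diag_entry_add: "diag_entry q (x + y) i = diag_entry q x i + diag_entry q y i"
  by (simp add: diag_entry_def free_rep_add free_char_add)

lemma free_rep_word:
  "free_rep q (Poly_Mapping.single (Word l) c) f i =
    c * (complex_of_real (path_weight q l i) * f (path l i))"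
  unfolding free_rep_single word_op_def word.sel foldr_gen_op ..

lemma free_char_word: "free_char (Poly_Mapping.single (Word l) c) = (if l = [] then c else 0)"
  by (cases l) (simp_all add: free_char_single)

text \<open>The empty word contributes nothing, because \<open>\<beta>\<close> removes the identity operator. With it the diagonal
  would not be summable.\<close>

lemma diag_entry_single:
  "diag_entry q (Poly_Mapping.single (Word l) c) i =
    (if l = [] then 0
     else c * (if path l i = i then complex_of_real (path_weight q l i) else 0))"
  by (simp add: diag_entry_def free_rep_word free_char_word ket_def)

lemma diag_entry_single_summable:
  assumes "\<bar>q\<bar> < 1"
  shows "diag_entry q (Poly_Mapping.single w c) summable_on UNIV"
proof -
  obtain l where w: "w = Word l" by (cases w)
  have "(\<lambda>(m, n). \<bar>q\<bar> ^ m * \<bar>q\<bar> ^ n) summable_on UNIV"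
    using has_sum_geometric_pair[of "\<bar>q\<bar>" "\<bar>q\<bar>"] assms by (auto simp: summable_on_def)
  then have "(\<lambda>i. cmod c * (case i of (m, n) \<Rightarrow> \<bar>q\<bar> ^ m * \<bar>q\<bar> ^ n)) summable_on UNIV"
    by (rule summable_on_cmult_right)
  moreover have "norm (diag_entry q (Poly_Mapping.single w c) (m, n)) \<le>
      cmod c * (\<bar>q\<bar> ^ m * \<bar>q\<bar> ^ n)" for m n
    using path_weight_le[OF assms, of l m n]
    by (auto simp: w diag_entry_single norm_mult power_add intro!: mult_left_mono)
  ultimately have "(\<lambda>i. norm (diag_entry q (Poly_Mapping.single w c) i)) summable_on UNIV"
    by (elim summable_on_comparison_test) auto
  then show ?thesis by (rule abs_summable_summable)
qed

lemma diag_entry_summable: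
  assumes "\<bar>q\<bar> < 1"
  shows "diag_entry q x summable_on UNIV"
proof -
  have "diag_entry q (\<Sum>w\<in>A. Poly_Mapping.single w (c w)) summable_on UNIV" if "finite A" for A c
    using that
  proof induction
    case empty
    then show ?case by (simp add: diag_entry_def[abs_def] free_rep_zero free_char_zero)
  next
    case (insert w A)
    then show ?case
      using diag_entry_single_summable[OF assms]
      by (simp add: diag_entry_add summable_on_add)
  qed
  then show ?thesis using monomials[of x] finite_keys by metis
qed

lemma reg_trace_add:
  assumes "\<bar>q\<bar> < 1"
  shows "reg_trace q (x + y) = reg_trace q x + reg_trace q y"
  by (simp add: reg_trace_def diag_entry_add infsum_add diag_entry_summable[OF assms])

lemma reg_trace_sum:
  assumes "\<bar>q\<bar> < 1"
  shows "reg_trace q (sum g A) = (\<Sum>a\<in>A. reg_trace q (g a))"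
proof -
  have "reg_trace q 0 = 0"
    by (simp add: reg_trace_def diag_entry_def free_rep_zero free_char_zero)
  then show ?thesis
    by (induction A rule: infinite_finite_induct) (simp_all add: reg_trace_add[OF assms])
qed

lemma reg_trace_one: "reg_trace q 1 = 0"
  by (simp add: reg_trace_def one_scal scal_def zero_word_def diag_entry_single)

text \<open>The trace of \<open>v w\<close> is a sum of weights over the closed paths that run through \<open>v\<close> and then \<open>w\<close>.
  Moving the base point past \<open>v\<close> turns these into the closed paths of \<open>w v\<close> with the same weights.\<close>

lemma reg_trace_word_commute:
  "reg_trace q (Poly_Mapping.single (v + w) c) = reg_trace q (Poly_Mapping.single (w + v) c)"
proof -
  obtain k l where vw: "v = Word k" "w = Word l" by (cases v; cases w)
  let ?P = "\<lambda>k l i. complex_of_real (path_weight q (k @ l) i)"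
  have *: "reg_trace q (Poly_Mapping.single (Word (k @ l)) c) =
      (if k @ l = [] then 0 else c * infsum (?P k l) {i. path l (path k i) = i})" for k l
  proof (cases "k @ l = []")
    case False
    then have "reg_trace q (Poly_Mapping.single (Word (k @ l)) c) =
        (\<Sum>\<^sub>\<infinity>i. c * (if path l (path k i) = i then ?P k l i else 0))"
      unfolding reg_trace_def diag_entry_single path_append by (simp only: if_False)
    also have "\<dots> = c * (\<Sum>\<^sub>\<infinity>i. if path l (path k i) = i then ?P k l i else 0)"
      by (rule infsum_cmult_right')
    also have "(\<Sum>\<^sub>\<infinity>i. if path l (path k i) = i then ?P k l i else 0) =
        infsum (?P k l) {i. path l (path k i) = i}"
      by (rule infsum_cong_neutral) auto
    finally show ?thesis using False by (simp only: if_False)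
  qed (simp add: reg_trace_def diag_entry_single)
  have "infsum (?P k l) {i. path l (path k i) = i} = infsum (?P l k) {i. path k (path l i) = i}"
    by (rule infsum_reindex_bij_witness[of _ "path l" "path k"])
      (simp_all add: path_weight_append mult.commute)
  moreover have "l @ k = [] \<longleftrightarrow> k @ l = []" by auto
  ultimately show ?thesis
    unfolding vw plus_word_def word.sel *[of k l] *[of l k] by (simp only:)
qed

lemma reg_trace_commute:
  assumes "\<bar>q\<bar> < 1"
  shows "reg_trace q (x * y) = reg_trace q (y * x)"
proof -
  have *: "reg_trace q (x * y) = (\<Sum>v\<in>Poly_Mapping.keys x. \<Sum>w\<in>Poly_Mapping.keys y.
      reg_trace q (Poly_Mapping.single (v + w) (Poly_Mapping.lookup x v * Poly_Mapping.lookup y w)))"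
    for x y
  proof -
    have "x * y = (\<Sum>v\<in>Poly_Mapping.keys x. \<Sum>w\<in>Poly_Mapping.keys y.
        Poly_Mapping.single v (Poly_Mapping.lookup x v) * Poly_Mapping.single w (Poly_Mapping.lookup y w))"
      using arg_cong2[of _ _ _ _ "(*)", OF monomials[of x] monomials[of y]] unfolding sum_product .
    then show ?thesis by (simp add: mult_single reg_trace_sum[OF assms])
  qed
  have "reg_trace q (x * y) = (\<Sum>v\<in>Poly_Mapping.keys x. \<Sum>w\<in>Poly_Mapping.keys y.
      reg_trace q (Poly_Mapping.single (w + v) (Poly_Mapping.lookup y w * Poly_Mapping.lookup x v)))"
    unfolding *[of x y] by (subst reg_trace_word_commute, subst mult.commute) (rule refl)
  also have "\<dots> = reg_trace q (y * x)"
    unfolding *[of y x] by (rule sum.swap)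
  finally show ?thesis .
qed

section \<open>Free images of idempotent matrices\<close>

lemma (in abelian_monoid) finsum_swap:
  assumes "finite A" "finite B" "\<And>i j. i \<in> A \<Longrightarrow> j \<in> B \<Longrightarrow> f i j \<in> carrier G"
  shows "(\<Oplus>i\<in>A. \<Oplus>j\<in>B. f i j) = (\<Oplus>j\<in>B. \<Oplus>i\<in>A. f i j)"
  using assms(1,3)
proof (induction A)
  case empty
  then show ?case by (simp add: finsum_zero)
next
  case (insert a A)
  then have "(\<Oplus>i\<in>insert a A. \<Oplus>j\<in>B. f i j) = (\<Oplus>j\<in>B. f a j) \<oplus> (\<Oplus>j\<in>B. \<Oplus>i\<in>A. f i j)"
    by (simp add: Pi_def)
  also have "\<dots> = (\<Oplus>j\<in>B. f a j \<oplus> (\<Oplus>i\<in>A. f i j))"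
    using insert.prems by (intro finsum_addf [symmetric]) (auto simp: Pi_def)
  also have "\<dots> = (\<Oplus>j\<in>B. \<Oplus>i\<in>insert a A. f i j)"
    using insert by (intro finsum_cong') (auto simp: Pi_def)
  finally show ?case .
qed

lemma (in abelian_monoid) finsum_in_additive:
  fixes h :: "'a \<Rightarrow> 'c::comm_monoid_add"
  assumes "h \<zero> = 0" "\<And>x y. x \<in> carrier G \<Longrightarrow> y \<in> carrier G \<Longrightarrow> h (x \<oplus> y) = h x + h y"
    and "finite A" "f \<in> A \<rightarrow> carrier G"
  shows "h (\<Oplus>i\<in>A. f i) = (\<Sum>i\<in>A. h (f i))"
  using assms(3,4) by induction (simp_all add: assms(1,2) Pi_def)

text \<open>The right module \<open>P[R\<^sup>I]\<close> over an arbitrary ring, in the encoding of \<^const>\<open>proj_module\<close>.\<close>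

definition matrix_image ::
    "('r, 'm) ring_scheme \<Rightarrow> 'i set \<Rightarrow> ('i \<Rightarrow> 'i \<Rightarrow> 'r) \<Rightarrow> ('r, 'i \<Rightarrow> 'r) module" where
  "matrix_image R I P =
     \<lparr>carrier = (\<lambda>F. \<lambda>i\<in>I. \<Oplus>\<^bsub>R\<^esub> j\<in>I. P i j \<otimes>\<^bsub>R\<^esub> F j) ` (I \<rightarrow>\<^sub>E carrier R),
      mult = undefined, one = undefined,
      zero = (\<lambda>i\<in>I. \<zero>\<^bsub>R\<^esub>),
      add = (\<lambda>F G. \<lambda>i\<in>I. F i \<oplus>\<^bsub>R\<^esub> G i),
      module.smult = (\<lambda>r F. \<lambda>i\<in>I. F i \<otimes>\<^bsub>R\<^esub> r)\<rparr>"

lemma proj_module_matrix_image: "proj_module q = matrix_image (qsphere q) {..<4} (qproj q)"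
  by (simp add: proj_module_def matrix_image_def mat_vec_def columns_def)

locale matrix_module = ring R for R (structure) +
  fixes I :: "'i set" and P :: "'i \<Rightarrow> 'i \<Rightarrow> 'a" and M
  assumes fin: "finite I"
    and P: "\<And>i j. i \<in> I \<Longrightarrow> j \<in> I \<Longrightarrow> P i j \<in> carrier R"
  defines "M \<equiv> matrix_image R I P"
begin

abbreviation app :: "('i \<Rightarrow> 'a) \<Rightarrow> 'i \<Rightarrow> 'a" where
  "app F \<equiv> \<lambda>i\<in>I. \<Oplus>j\<in>I. P i j \<otimes> F j"

lemma carrier_M: "carrier M = app ` (I \<rightarrow>\<^sub>E carrier R)"
  and zero_M: "\<zero>\<^bsub>M\<^esub> = (\<lambda>i\<in>I. \<zero>)"
  and add_M: "F \<oplus>\<^bsub>M\<^esub> G = (\<lambda>i\<in>I. F i \<oplus> G i)"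
  and smult_M: "r \<odot>\<^bsub>M\<^esub> F = (\<lambda>i\<in>I. F i \<otimes> r)"
  by (simp_all add: M_def matrix_image_def)

lemma app_closed: "F \<in> I \<rightarrow> carrier R \<Longrightarrow> app F \<in> carrier M"
proof -
  assume F: "F \<in> I \<rightarrow> carrier R"
  then have "app F = app (restrict F I)"
    using P by (auto simp: restrict_def fun_eq_iff Pi_def intro!: finsum_cong')
  then show ?thesis using F unfolding carrier_M by (intro image_eqI[of _ _ "restrict F I"]) auto
qed

lemma carrier_M_sub: "carrier M \<subseteq> I \<rightarrow>\<^sub>E carrier R"
  unfolding carrier_M using P by (auto simp: Pi_def PiE_def intro!: finsum_closed)

lemma carrier_M_nth: "x \<in> carrier M \<Longrightarrow> i \<in> I \<Longrightarrow> x i \<in> carrier R"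
  using carrier_M_sub by auto

lemma carrier_M_eqI:
  "x \<in> carrier M \<Longrightarrow> y \<in> carrier M \<Longrightarrow> (\<And>i. i \<in> I \<Longrightarrow> x i = y i) \<Longrightarrow> x = y"
  using carrier_M_sub by (intro PiE_ext[of x I "\<lambda>_. carrier R" y]) auto

lemma app_add:
  assumes "F \<in> I \<rightarrow> carrier R" "G \<in> I \<rightarrow> carrier R"
  shows "app F \<oplus>\<^bsub>M\<^esub> app G = app (\<lambda>i. F i \<oplus> G i)"
proof -
  have "(\<Oplus>j\<in>I. P i j \<otimes> F j) \<oplus> (\<Oplus>j\<in>I. P i j \<otimes> G j) = (\<Oplus>j\<in>I. P i j \<otimes> (F j \<oplus> G j))"
    if "i \<in> I" for i
  proof -
    have "(\<Oplus>j\<in>I. P i j \<otimes> F j) \<oplus> (\<Oplus>j\<in>I. P i j \<otimes> G j) =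
        (\<Oplus>j\<in>I. P i j \<otimes> F j \<oplus> P i j \<otimes> G j)"
      using assms P that by (intro finsum_addf [symmetric]) auto
    also have "\<dots> = (\<Oplus>j\<in>I. P i j \<otimes> (F j \<oplus> G j))"
      using assms P that by (intro finsum_cong') (auto simp: r_distr Pi_def)
    finally show ?thesis .
  qed
  then show ?thesis by (auto simp: add_M fun_eq_iff)
qed

lemma app_smult:
  assumes "F \<in> I \<rightarrow> carrier R" "r \<in> carrier R"
  shows "r \<odot>\<^bsub>M\<^esub> app F = app (\<lambda>i. F i \<otimes> r)"
proof -
  have "(\<Oplus>j\<in>I. P i j \<otimes> F j) \<otimes> r = (\<Oplus>j\<in>I. P i j \<otimes> (F j \<otimes> r))" if "i \<in> I" for i
    using assms P fin that
    by (subst finsum_ldistr) (auto simp: Pi_def m_assoc intro!: finsum_cong')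
  then show ?thesis by (auto simp: smult_M fun_eq_iff)
qed

lemma app_zero: "\<zero>\<^bsub>M\<^esub> = app (\<lambda>_. \<zero>)"
proof -
  have "(\<Oplus>j\<in>I. P i j \<otimes> \<zero>) = \<zero>" if "i \<in> I" for i
    using P that by (intro add.finprod_one_eqI) auto
  then show ?thesis by (auto simp: zero_M fun_eq_iff)
qed

lemma smult_closed: "x \<in> carrier M \<Longrightarrow> r \<in> carrier R \<Longrightarrow> r \<odot>\<^bsub>M\<^esub> x \<in> carrier M"
  using app_smult app_closed by (fastforce simp: carrier_M Pi_def PiE_def)

lemma abelian_monoid_M: "abelian_monoid M"
proof (rule abelian_monoidI)
  show "x \<oplus>\<^bsub>M\<^esub> y \<in> carrier M" if "x \<in> carrier M" "y \<in> carrier M" for x y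
  proof -
    obtain F where F: "F \<in> I \<rightarrow>\<^sub>E carrier R" "x = app F"
      using \<open>x \<in> carrier M\<close> unfolding carrier_M by (rule imageE)
    obtain G where G: "G \<in> I \<rightarrow>\<^sub>E carrier R" "y = app G"
      using \<open>y \<in> carrier M\<close> unfolding carrier_M by (rule imageE)
    from F G show ?thesis
      using app_add[of F G] app_closed[of "\<lambda>i. F i \<oplus> G i"] by (auto simp: PiE_def Pi_def)
  qed
  show "\<zero>\<^bsub>M\<^esub> \<in> carrier M" unfolding app_zero by (rule app_closed) auto
  fix x y z assume "x \<in> carrier M" "y \<in> carrier M" "z \<in> carrier M"
  then have [simp]: "x i \<in> carrier R" "y i \<in> carrier R" "z i \<in> carrier R"  if "i \<in> I" for i
    using that carrier_M_nth by auto
  show "x \<oplus>\<^bsub>M\<^esub> y \<oplus>\<^bsub>M\<^esub> z = x \<oplus>\<^bsub>M\<^esub> (y \<oplus>\<^bsub>M\<^esub> z)"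
    by (auto simp: add_M fun_eq_iff a_assoc)
  show "x \<oplus>\<^bsub>M\<^esub> y = y \<oplus>\<^bsub>M\<^esub> x"
    by (auto simp: add_M fun_eq_iff a_comm)
  show "\<zero>\<^bsub>M\<^esub> \<oplus>\<^bsub>M\<^esub> x = x"
    using \<open>x \<in> carrier M\<close> carrier_M_sub by (auto simp: add_M zero_M fun_eq_iff PiE_def extensional_def)
qed

lemma finsum_M_nth:
  assumes "finite A" "f \<in> A \<rightarrow> carrier M" "i \<in> I"
  shows "(\<Oplus>\<^bsub>M\<^esub>v\<in>A. f v) i = (\<Oplus>v\<in>A. f v i)"
proof -
  interpret M: abelian_monoid M by (rule abelian_monoid_M)
  show ?thesis
    using assms(1,2)
  proof induction
    case empty
    then show ?case using assms(3) by (simp add: zero_M)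
  next
    case (insert v A)
    then show ?case
      using assms(3) by (simp add: Pi_def carrier_M_nth) (simp add: add_M)
  qed
qed

text \<open>The sum in the definition of a basis ranges over the support of the coefficients. Summing over any
  larger finite set \<open>S\<close> instead lets combinations with different supports be compared.\<close>

lemma linear_combination_nth:
  assumes "B \<subseteq> carrier M" "c \<in> B \<rightarrow> carrier R" "finite S" "S \<subseteq> B"
    and supp: "\<And>v. v \<in> B - S \<Longrightarrow> c v = \<zero>" and "i \<in> I"
  shows "(\<Oplus>\<^bsub>M\<^esub>v\<in>{v \<in> B. c v \<noteq> \<zero>}. c v \<odot>\<^bsub>M\<^esub> v) i = (\<Oplus>v\<in>S. v i \<otimes> c v)"
proof -
  have sub: "{v \<in> B. c v \<noteq> \<zero>} \<subseteq> S" using supp by auto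
  then have fin': "finite {v \<in> B. c v \<noteq> \<zero>}" using assms(3) finite_subset by blast
  have [simp]: "v i \<in> carrier R" "c v \<in> carrier R" if "v \<in> B" for v
    using that assms carrier_M_nth by auto
  have "(\<Oplus>\<^bsub>M\<^esub>v\<in>{v \<in> B. c v \<noteq> \<zero>}. c v \<odot>\<^bsub>M\<^esub> v) i = (\<Oplus>v\<in>{v \<in> B. c v \<noteq> \<zero>}. (c v \<odot>\<^bsub>M\<^esub> v) i)"
    using assms by (intro finsum_M_nth[OF fin']) (auto intro!: smult_closed)
  also have "\<dots> = (\<Oplus>v\<in>{v \<in> B. c v \<noteq> \<zero>}. v i \<otimes> c v)"
    using assms by (intro finsum_cong') (auto simp: smult_M)
  also have "\<dots> = (\<Oplus>v\<in>S. v i \<otimes> c v)"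
    using assms sub by (intro add.finprod_mono_neutral_cong_left) auto
  finally show ?thesis .
qed

end

locale idempotent_module = matrix_module R I P M
  for R (structure) and I :: "'i set" and P :: "'i \<Rightarrow> 'i \<Rightarrow> 'a" and M +
  assumes idem: "\<And>i k. i \<in> I \<Longrightarrow> k \<in> I \<Longrightarrow> (\<Oplus>j\<in>I. P i j \<otimes> P j k) = P i k"
begin

lemma app_id:
  assumes "x \<in> carrier M"
  shows "app x = x"
proof -
  obtain F where F: "\<And>i. i \<in> I \<Longrightarrow> F i \<in> carrier R" and x: "x = app F"
    using assms unfolding carrier_M by (auto simp: PiE_def Pi_def)
  have "(\<Oplus>j\<in>I. P i j \<otimes> x j) = x i" if i: "i \<in> I" for i
  proof -
    have "(\<Oplus>j\<in>I. P i j \<otimes> x j) = (\<Oplus>j\<in>I. \<Oplus>k\<in>I. P i j \<otimes> P j k \<otimes> F k)"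
      using P F i fin unfolding x
      by (intro finsum_cong') (auto simp: finsum_rdistr Pi_def m_assoc intro!: finsum_closed finsum_cong')
    also have "\<dots> = (\<Oplus>k\<in>I. \<Oplus>j\<in>I. P i j \<otimes> P j k \<otimes> F k)"
      using P F i fin by (intro finsum_swap) auto
    also have "\<dots> = (\<Oplus>k\<in>I. P i k \<otimes> F k)"
      using P F i fin by (intro finsum_cong') (auto simp: Pi_def idem finsum_ldistr [symmetric])
    finally show ?thesis using i by (simp add: x)
  qed
  then show ?thesis
    using assms by (intro carrier_M_eqI app_closed) (auto simp: carrier_M_nth)
qed

text \<open>A finite subset \<open>S\<close> of the basis suffices, because the columns of \<open>P\<close> generate the module. Take
  for \<open>u\<close> the matrix whose columns are the elements of \<open>S\<close>, and for \<open>w\<close> the coefficients of the columns of \<open>P\<close>.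
  Then \<open>P = u w\<close>. As \<open>P\<close> fixes each \<open>v \<in> S\<close>, also \<open>v = u (w v)\<close>, so \<open>w v\<close> is a coefficient vector of the basis
  element \<open>v\<close>; uniqueness of coefficients forces it to be the unit vector, that is \<open>w u = 1\<close>.\<close>

theorem basis_factorization:
  assumes basis: "is_basis R M B"
  shows "\<exists>(S :: ('i \<Rightarrow> 'a) set) u w. finite S \<and>
    (\<forall>i\<in>I. \<forall>v\<in>S. u i v \<in> carrier R \<and> w v i \<in> carrier R) \<and>
    (\<forall>i\<in>I. \<forall>j\<in>I. P i j = (\<Oplus>v\<in>S. u i v \<otimes> w v j)) \<and>
    (\<forall>v\<in>S. \<forall>v'\<in>S. (\<Oplus>i\<in>I. w v i \<otimes> u i v') = (if v = v' then \<one> else \<zero>))"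
proof -
  have BM: "B \<subseteq> carrier M" using basis unfolding is_basis_def by (rule conjunct1)
  define coeffs where "coeffs x c \<longleftrightarrow> c \<in> B \<rightarrow>\<^sub>E carrier R \<and> finite {v\<in>B. c v \<noteq> \<zero>} \<and>
    x = (\<Oplus>\<^bsub>M\<^esub> v\<in>{v\<in>B. c v \<noteq> \<zero>}. c v \<odot>\<^bsub>M\<^esub> v)" for x c
  have ex1: "\<exists>!c. coeffs x c" if "x \<in> carrier M" for x
    unfolding coeffs_def using conjunct2[OF basis[unfolded is_basis_def]] that by (rule bspec)
  define col where "col j = (\<lambda>i\<in>I. P i j)" for j
  have col: "col j \<in> carrier M" if j: "j \<in> I" for j
  proof -
    have "(\<Oplus>k\<in>I. P i k \<otimes> (if j = k then \<one> else \<zero>)) = P i j" if "i \<in> I" for i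
    proof -
      have "(\<Oplus>k\<in>I. P i k \<otimes> (if j = k then \<one> else \<zero>)) = (\<Oplus>k\<in>I. if j = k then P i k else \<zero>)"
        using P that by (intro finsum_cong') auto
      also have "\<dots> = P i j" using P that j fin by (intro finsum_singleton) auto
      finally show ?thesis .
    qed
    then have "col j = app (\<lambda>k. if j = k then \<one> else \<zero>)"
      by (auto simp: col_def fun_eq_iff)
    then show ?thesis using app_closed[of "\<lambda>k. if j = k then \<one> else \<zero>"] by auto
  qed
  obtain c where c: "\<And>j. j \<in> I \<Longrightarrow> coeffs (col j) (c j)"
  proof (rule that)
    show "coeffs (col j) (SOME c. coeffs (col j) c)" if "j \<in> I" for j
      by (rule someI_ex[OF ex1_implies_ex[OF ex1[OF col[OF that]]]])
  qed
  define S where "S = (\<Union>j\<in>I. {v\<in>B. c j v \<noteq> \<zero>})"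
  have S: "finite S" "S \<subseteq> B" using c fin by (auto simp: S_def coeffs_def)
  have cR: "c j v \<in> carrier R" if "j \<in> I" "v \<in> B" for j v
    using c[OF that(1)] that(2) by (auto simp: coeffs_def)
  have c0: "c j v = \<zero>" if "j \<in> I" "v \<in> B - S" for j v
    using that by (auto simp: S_def)
  have vR: "v i \<in> carrier R" if "v \<in> B" "i \<in> I" for v i
    using that BM carrier_M_nth by auto
  have Puw: "P i j = (\<Oplus>v\<in>S. v i \<otimes> c j v)" if "i \<in> I" "j \<in> I" for i j
  proof -
    have "P i j = col j i" using that by (simp add: col_def)
    also have "\<dots> = (\<Oplus>\<^bsub>M\<^esub> v\<in>{v\<in>B. c j v \<noteq> \<zero>}. c j v \<odot>\<^bsub>M\<^esub> v) i"
      using c[OF that(2)] by (simp add: coeffs_def)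
    also have "\<dots> = (\<Oplus>v\<in>S. v i \<otimes> c j v)"
      using that by (intro linear_combination_nth[OF BM _ S]) (auto simp: c0 cR)
    finally show ?thesis .
  qed
  have wu: "(\<Oplus>i\<in>I. c i v \<otimes> v0 i) = (if v = v0 then \<one> else \<zero>)" if v0: "v0 \<in> S" and "v \<in> S" for v0 v
  proof -
    have v0M: "v0 \<in> carrier M" using v0 S BM by auto
    define d where "d = (\<lambda>v\<in>B. \<Oplus>j\<in>I. c j v \<otimes> v0 j)"
    define e where "e = (\<lambda>v\<in>B. if v0 = v then \<one> else \<zero>)"
    have dR: "d v \<in> carrier R" if "v \<in> B" for v
      using that v0 S by (auto simp: d_def cR vR intro!: finsum_closed)
    have d0: "d v = \<zero>" if "v \<in> B - S" for v
      using that v0 S by (auto simp: d_def c0 vR intro!: add.finprod_one_eqI)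
    have coeffsI: "coeffs v0 f" if f: "f \<in> B \<rightarrow>\<^sub>E carrier R" "\<And>v. v \<in> B - S \<Longrightarrow> f v = \<zero>"
      "\<And>i. i \<in> I \<Longrightarrow> v0 i = (\<Oplus>v\<in>S. v i \<otimes> f v)" for f
    proof -
      interpret M: abelian_monoid M by (rule abelian_monoid_M)
      have "{v\<in>B. f v \<noteq> \<zero>} \<subseteq> S" using f(2) by auto
      moreover have "(\<Oplus>\<^bsub>M\<^esub> v\<in>{v\<in>B. f v \<noteq> \<zero>}. f v \<odot>\<^bsub>M\<^esub> v) \<in> carrier M"
        using f(1) BM by (intro M.finsum_closed) (auto intro!: smult_closed)
      moreover have "(\<Oplus>\<^bsub>M\<^esub> v\<in>{v\<in>B. f v \<noteq> \<zero>}. f v \<odot>\<^bsub>M\<^esub> v) i = v0 i" if "i \<in> I" for i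
        using f that by (subst linear_combination_nth[OF BM _ S]) auto
      ultimately show ?thesis
        using f(1) S v0M unfolding coeffs_def
        by (auto intro: finite_subset carrier_M_eqI)
    qed
    \<comment> \<open>Two expansions of the basis element: one through the factorization, one tautological.\<close>
    have "coeffs v0 d"
    proof (rule coeffsI)
      fix i assume i: "i \<in> I"
      have "v0 i = (\<Oplus>j\<in>I. P i j \<otimes> v0 j)"
        using i by (subst app_id[OF v0M, symmetric]) simp
      also have "\<dots> = (\<Oplus>j\<in>I. \<Oplus>v\<in>S. v i \<otimes> (c j v \<otimes> v0 j))"
      proof (intro finsum_cong' refl)
        fix j assume j: "j \<in> I"
        show "P i j \<otimes> v0 j = (\<Oplus>v\<in>S. v i \<otimes> (c j v \<otimes> v0 j))"
          unfolding Puw[OF i j] using i j S v0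
          by (subst finsum_ldistr) (auto simp: cR vR m_assoc subset_eq intro!: finsum_cong')
      qed (use i S v0 in \<open>auto simp: cR vR subset_eq intro!: finsum_closed\<close>)
      also have "\<dots> = (\<Oplus>v\<in>S. \<Oplus>j\<in>I. v i \<otimes> (c j v \<otimes> v0 j))"
        using i S v0 fin by (intro finsum_swap) (auto simp: cR vR subset_eq)
      also have "\<dots> = (\<Oplus>v\<in>S. v i \<otimes> d v)"
        using i S v0 fin dR
        by (intro finsum_cong') (auto simp: cR vR subset_eq d_def finsum_rdistr intro!: finsum_cong')
      finally show "v0 i = (\<Oplus>v\<in>S. v i \<otimes> d v)" .
    qed (use dR d0 in \<open>auto simp: d_def\<close>)
    moreover have "coeffs v0 e"
    proof (rule coeffsI)
      fix i assume i: "i \<in> I"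
      have "(\<Oplus>v\<in>S. v i \<otimes> e v) = (\<Oplus>v\<in>S. if v0 = v then v i else \<zero>)"
        using i S by (intro finsum_cong') (auto simp: e_def vR subset_eq)
      also have "\<dots> = v0 i" using v0 S i by (intro finsum_singleton) (auto simp: vR subset_eq)
      finally show "v0 i = (\<Oplus>v\<in>S. v i \<otimes> e v)" by simp
    qed (use v0 in \<open>auto simp: e_def\<close>)
    ultimately have "d v = e v" using ex1[OF v0M] by auto
    then show ?thesis using that S by (auto simp: d_def e_def)
  qed
  show ?thesis
    by (intro exI[of _ S] exI[of _ "\<lambda>i v. v i"] exI[of _ "\<lambda>v i. c i v"] conjI ballI)
      (use S Puw wu in \<open>auto simp: cR vR subset_eq\<close>)
qed

text \<open>If \<open>P = u w\<close> and \<open>w u = 1\<close> has size \<open>n\<close>, a trace cannot distinguish \<open>P\<close> from the unit matrix of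
  size \<open>n\<close>.\<close>

theorem trace_of_free:
  fixes tau :: "'a \<Rightarrow> complex"
  assumes "free_module R M"
    and tau_add: "\<And>x y. x \<in> carrier R \<Longrightarrow> y \<in> carrier R \<Longrightarrow> tau (x \<oplus> y) = tau x + tau y"
    and tau_comm: "\<And>x y. x \<in> carrier R \<Longrightarrow> y \<in> carrier R \<Longrightarrow> tau (x \<otimes> y) = tau (y \<otimes> x)"
  shows "\<exists>n::nat. tau (\<Oplus>i\<in>I. P i i) = of_nat n * tau \<one>"
proof -
  obtain B where "is_basis R M B" using assms(1) by (auto simp: free_module_def)
  from basis_factorization[OF this] obtain S :: "('i \<Rightarrow> 'a) set" and u w where S: "finite S"
    and uw: "\<forall>i\<in>I. \<forall>v\<in>S. u i v \<in> carrier R \<and> w v i \<in> carrier R"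
    and P_eq: "\<forall>i\<in>I. \<forall>j\<in>I. P i j = (\<Oplus>v\<in>S. u i v \<otimes> w v j)"
    and wu: "\<forall>v\<in>S. \<forall>v'\<in>S. (\<Oplus>i\<in>I. w v i \<otimes> u i v') = (if v = v' then \<one> else \<zero>)"
    by (elim exE conjE)
  have "tau \<zero> = 0" using tau_add[of \<zero> \<zero>] by simp
  note tau_sum = finsum_in_additive[where h = tau, OF this tau_add]
  have "tau (\<Oplus>i\<in>I. P i i) = (\<Sum>i\<in>I. tau (P i i))"
    using P fin by (intro tau_sum) auto
  also have "\<dots> = (\<Sum>i\<in>I. \<Sum>v\<in>S. tau (u i v \<otimes> w v i))"
    using S uw by (intro sum.cong) (auto simp: P_eq intro!: tau_sum)
  also have "\<dots> = (\<Sum>i\<in>I. \<Sum>v\<in>S. tau (w v i \<otimes> u i v))"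
    using uw by (intro sum.cong refl tau_comm) auto
  also have "\<dots> = (\<Sum>v\<in>S. \<Sum>i\<in>I. tau (w v i \<otimes> u i v))" by (rule sum.swap)
  also have "\<dots> = (\<Sum>v\<in>S. tau (\<Oplus>i\<in>I. w v i \<otimes> u i v))"
    using fin uw by (intro sum.cong refl tau_sum [symmetric]) auto
  also have "\<dots> = of_nat (card S) * tau \<one>"
    by (simp add: wu)
  finally show ?thesis by blast
qed

end

section \<open>The projection over the quantum sphere\<close>

lemma ideal_rel_ideal: "ideal (rel_ideal q) free_ring"
proof -
  interpret ring free_ring by (rule ring_free_ring)
  show ?thesis unfolding rel_ideal_def by (rule genideal_ideal) (simp add: free_ring_def)
qed

lemma free_ring_simps:
  "carrier free_ring = UNIV" "x \<otimes>\<^bsub>free_ring\<^esub> y = x * y" "x \<oplus>\<^bsub>free_ring\<^esub> y = x + y"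
  "\<one>\<^bsub>free_ring\<^esub> = 1" "\<zero>\<^bsub>free_ring\<^esub> = 0"
  by (simp_all add: free_ring_def)

lemma ring_qsphere: "ring (qsphere q)"
  unfolding qsphere_def by (rule ideal.quotient_is_ring[OF ideal_rel_ideal])

lemma cls_ring_hom: "ring_hom_ring free_ring (qsphere q) (cls q)"
  using ideal.rcos_ring_hom_ring[OF ideal_rel_ideal, of q]
  by (simp add: qsphere_def cls_def[abs_def])

lemma cls_closed: "cls q x \<in> carrier (qsphere q)"
  and cls_add: "cls q (x + y) = cls q x \<oplus>\<^bsub>qsphere q\<^esub> cls q y"
  and cls_mult: "cls q (x * y) = cls q x \<otimes>\<^bsub>qsphere q\<^esub> cls q y"
  and cls_one: "cls q 1 = \<one>\<^bsub>qsphere q\<^esub>"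
  and cls_zero: "cls q 0 = \<zero>\<^bsub>qsphere q\<^esub>"
proof -
  interpret h: ring_hom_ring free_ring "qsphere q" "cls q" by (rule cls_ring_hom)
  show "cls q x \<in> carrier (qsphere q)" using h.hom_closed[of x] by (simp add: free_ring_simps)
  show "cls q (x + y) = cls q x \<oplus>\<^bsub>qsphere q\<^esub> cls q y"
    using h.hom_add[of x y] by (simp add: free_ring_simps)
  show "cls q (x * y) = cls q x \<otimes>\<^bsub>qsphere q\<^esub> cls q y"
    using h.hom_mult[of x y] by (simp add: free_ring_simps)
  show "cls q 1 = \<one>\<^bsub>qsphere q\<^esub>" using h.hom_one by (simp add: free_ring_simps)
  show "cls q 0 = \<zero>\<^bsub>qsphere q\<^esub>" using h.hom_zero by (simp add: free_ring_simps)
qed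

lemma carrier_qsphere: "c \<in> carrier (qsphere q) \<Longrightarrow> \<exists>x. c = cls q x"
  by (auto simp: qsphere_def FactRing_def A_RCOSETS_def' free_ring_simps cls_def)

lemma cls_sum:
  assumes "finite A"
  shows "(\<Oplus>\<^bsub>qsphere q\<^esub>i\<in>A. cls q (f i)) = cls q (sum f A)"
proof -
  interpret ring "qsphere q" by (rule ring_qsphere)
  show ?thesis
    using assms by induction (simp_all add: cls_closed cls_add cls_zero Pi_def)
qed

lemma rel_ideal_add: "x \<in> rel_ideal q \<Longrightarrow> y \<in> rel_ideal q \<Longrightarrow> x + y \<in> rel_ideal q"
  using additive_subgroup.a_closed[OF ideal.axioms(1)[OF ideal_rel_ideal]]
  by (simp add: free_ring_simps)

lemma rel_ideal_mult: "x \<in> rel_ideal q \<Longrightarrow> y * x \<in> rel_ideal q"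
  using ideal.I_l_closed[OF ideal_rel_ideal] by (simp add: free_ring_simps)

lemma cls_eqI:
  assumes "x - y \<in> rel_ideal q"
  shows "cls q x = cls q y"
proof -
  interpret ring "qsphere q" by (rule ring_qsphere)
  interpret i: ideal "rel_ideal q" free_ring by (rule ideal_rel_ideal)
  have "cls q (x - y) = cls q 0"
    using i.a_rcos_const[OF assms] i.a_rcos_const[OF additive_subgroup.zero_closed[OF ideal.axioms(1)[OF ideal_rel_ideal]]]
    by (simp add: cls_def free_ring_simps)
  then have "cls q (x - y) \<oplus>\<^bsub>qsphere q\<^esub> cls q y = cls q 0 \<oplus>\<^bsub>qsphere q\<^esub> cls q y" by simp
  then show ?thesis by (simp flip: cls_add)
qed

lemma relations_sub: "relations q \<subseteq> rel_ideal q"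
proof -
  interpret ring free_ring by (rule ring_free_ring)
  show ?thesis unfolding rel_ideal_def by (rule genideal_self) (simp add: free_ring_simps)
qed

lemma qpow_central: "x * qpow q k = qpow q k * x"
proof -
  have "Poly_Mapping.single w c * qpow q k = qpow q k * Poly_Mapping.single w c" for w c
    by (simp add: qpow_def scal_def mult_single mult.commute)
  then show ?thesis
    by (subst (1 2) monomials[of x]) (simp only: sum_distrib_left sum_distrib_right)
qed

lemma qpow_mult:
  assumes "q \<noteq> 0"
  shows "qpow q j * qpow q k = qpow q (j + k)"
  using assms by (simp add: qpow_def scal_def mult_single power_int_add)

lemma qpow_0: "qpow q 0 = 1"
  by (simp add: qpow_def one_scal)

text \<open>The relations make the matrix idempotent: every entry of \<open>p\<^sup>2 - p\<close> is a
  combination of at most two of them, with powers of \<open>q\<close> as coefficients.\<close>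

lemma proj_entries_idempotent:
  assumes q: "q \<noteq> 0" and "i < 4" "k < 4"
  shows "(\<Sum>j<4. proj_entries q ! i ! j * proj_entries q ! j ! k) - proj_entries q ! i ! k \<in> rel_ideal q"
    (is "?D i k \<in> _")
proof -
  define a a' b b' t where abt: "a = letter Ga" "a' = letter Gabar" "b = letter Gb"
    "b' = letter Gbbar" "t = letter Gt"
  let ?c = "qpow q"
  define r where "r = [
    a * b - ?c 4 * (b * a),
    a' * b - b * a',
    t * a - ?c (-2) * (a * t),
    t * b - ?c 4 * (b * t),
    (a * a' + b * b') - ?c (-2) * t * (1 - ?c (-2) * t),
    (?c 4 * (a' * a) + ?c (-4) * (b' * b)) - t * (1 - t),
    (b * b' - ?c (-4) * (b' * b)) - (1 - ?c (-4)) * (t * t)]"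
  \<comment> \<open>The conjugates of the first four relations.\<close>
  define s where "s = [
    b' * a' - a' * b' * ?c 4,
    b' * a - a * b',
    a' * t - t * a' * ?c (-2),
    b' * t - t * b' * ?c 4]"
  have "set r \<subseteq> basic_relations q"
    by (simp add: r_def basic_relations_def abt Let_def power2_eq_square)
  moreover have "set s \<subseteq> star ` basic_relations q"
    by (simp add: s_def basic_relations_def abt Let_def st power2_eq_square)
  ultimately have rs: "x \<in> rel_ideal q" if "x \<in> set r \<union> set s" for x
    using that relations_sub[of q] by (auto simp: relations_def)
  have len: "length r = 7" "length s = 4" by (simp_all add: r_def s_def)
  have r_in: "?c j * r ! n \<in> rel_ideal q" "- (?c j * r ! n) \<in> rel_ideal q" if "n < 7" for j n
  proof -
    have "r ! n \<in> rel_ideal q" using nth_mem[of n r] that by (intro rs) (simp only: len UnI1)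
    then show "?c j * r ! n \<in> rel_ideal q" "- (?c j * r ! n) \<in> rel_ideal q"
      using rel_ideal_mult[of "r ! n" q "- ?c j"] by (simp_all only: rel_ideal_mult mult_minus_left)
  qed
  have s_in: "?c j * s ! n \<in> rel_ideal q" "- (?c j * s ! n) \<in> rel_ideal q" if "n < 4" for j n
  proof -
    have "s ! n \<in> rel_ideal q" using nth_mem[of n s] that by (intro rs) (simp only: len UnI2)
    then show "?c j * s ! n \<in> rel_ideal q" "- (?c j * s ! n) \<in> rel_ideal q"
      using rel_ideal_mult[of "s ! n" q "- ?c j"] by (simp_all only: rel_ideal_mult mult_minus_left)
  qed
  \<comment> \<open>Moving the powers of \<open>q\<close> to the front and collecting them there gives a normal form. Centrality is used
    for single letters only, since the general rule would rewrite products of powers forever.\<close>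
  note comm = qpow_central[of a] qpow_central[of a'] qpow_central[of b] qpow_central[of b']
    qpow_central[of t]
  have comm2: "a * (?c j * z) = ?c j * (a * z)" "a' * (?c j * z) = ?c j * (a' * z)"
     "b * (?c j * z) = ?c j * (b * z)" "b' * (?c j * z) = ?c j * (b' * z)"
     "t * (?c j * z) = ?c j * (t * z)" for j z
    using qpow_central by (metis mult.assoc)+
  have qq: "?c j * ?c k = ?c (j + k)" "?c j * (?c k * z) = ?c (j + k) * z" for j k z
    by (simp_all add: qpow_mult[OF q] mult.assoc [symmetric])
  note simps = r_def s_def algebra_simps comm comm2 qq qpow_0
  have n4: "{..<4} = {0, 1, 2, 3 :: nat}" by auto
  have "?D 0 0 = ?c 0 * r ! 4" "?D 0 1 = ?c (-2) * r ! 0"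
    "?D 0 2 = ?c (-2) * r ! 2" "?D 0 3 = ?c (-2) * r ! 3"
    "?D 1 0 = ?c (-2) * s ! 0" "?D 1 1 = ?c 0 * r ! 5"
    "?D 1 2 = - (?c (-6) * s ! 3)" "?D 1 3 = ?c 4 * s ! 2"
    "?D 2 0 = ?c (-2) * s ! 2" "?D 2 1 = - (?c (-6) * r ! 3)"
    "?D 2 2 = ?c (-4) * r ! 5 + ?c (-4) * r ! 6" "?D 2 3 = ?c 0 * r ! 1"
    "?D 3 0 = ?c (-2) * s ! 3" "?D 3 1 = ?c 4 * r ! 2"
    "?D 3 2 = ?c 0 * s ! 1" "?D 3 3 = ?c 4 * r ! 4 + - (?c 4 * r ! 6)"
    unfolding n4 proj_entries_def Let_def abt [symmetric]
    by (simp_all add: simps)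
  moreover have "i = 0 \<or> i = 1 \<or> i = 2 \<or> i = 3" "k = 0 \<or> k = 1 \<or> k = 2 \<or> k = 3"
    using assms by auto
  ultimately show ?thesis
    by (elim disjE; simp only:) (intro r_in s_in rel_ideal_add; simp)+
qed

section \<open>Traces of diagonal operators\<close>

lemma inner_prod_ket: "inner_prod (ket m n) f = f (m, n)"
proof -
  have "inner_prod (ket m n) f = (\<Sum>\<^sub>\<infinity>i\<in>{(m, n)}. cnj (ket m n i) * f i)"
    unfolding inner_prod_def by (rule infsum_cong_neutral) (auto simp: ket_def)
  then show ?thesis by (simp add: ket_def)
qed

lemma bounded_op_diagonal:
  assumes bound: "\<And>i. cmod (d i) \<le> K"
  shows "bounded_op (\<lambda>f i. d i * f i)"
proof -
  have le: "(cmod (d i * f i))\<^sup>2 \<le> K\<^sup>2 * (cmod (f i))\<^sup>2" for f :: vec and i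
    using bound[of i] by (simp add: norm_mult power_mult_distrib mult_right_mono power_mono)
  have summ: "(\<lambda>i. K\<^sup>2 * (cmod (f i))\<^sup>2) summable_on UNIV" if "f \<in> hilb" for f
    using that by (auto simp: hilb_def intro: summable_on_cmult_right)
  have closed: "(\<lambda>i. d i * f i) \<in> hilb" if "f \<in> hilb" for f
    unfolding hilb_def mem_Collect_eq
    by (rule summable_on_comparison_test[OF summ[OF that]]) (use le in auto)
  have "hnorm (\<lambda>i. d i * f i) \<le> \<bar>K\<bar> * hnorm f" if f: "f \<in> hilb" for f
  proof -
    have "(\<Sum>\<^sub>\<infinity>i. (cmod (d i * f i))\<^sup>2) \<le> (\<Sum>\<^sub>\<infinity>i. K\<^sup>2 * (cmod (f i))\<^sup>2)"
      using closed[OF f] summ[OF f] le by (intro infsum_mono) (auto simp: hilb_def)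
    also have "\<dots> = K\<^sup>2 * (\<Sum>\<^sub>\<infinity>i. (cmod (f i))\<^sup>2)"
      by (rule infsum_cmult_right')
    finally have "hnorm (\<lambda>i. d i * f i) \<le> sqrt (K\<^sup>2 * (\<Sum>\<^sub>\<infinity>i. (cmod (f i))\<^sup>2))"
      unfolding hnorm_def by (rule real_sqrt_le_mono)
    then show ?thesis by (simp add: hnorm_def real_sqrt_mult)
  qed
  then show ?thesis
    using closed unfolding bounded_op_def
    by (intro conjI exI[of _ "\<bar>K\<bar>"]) (simp_all add: distrib_left mult.left_commute)
qed

lemma inner_prod_diagonal_nonneg:
  assumes "\<And>i. 0 \<le> r i"
  shows "inner_prod f (\<lambda>i. complex_of_real (r i) * f i) \<in> \<real>\<^sub>\<ge>\<^sub>0"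
proof -
  have "cnj (f i) * (complex_of_real (r i) * f i) = complex_of_real (r i * (cmod (f i))\<^sup>2)" for i
    using complex_norm_square[of "f i"] by (simp add: mult_ac)
  then have eq: "inner_prod f (\<lambda>i. complex_of_real (r i) * f i) =
      (\<Sum>\<^sub>\<infinity>i. complex_of_real (r i * (cmod (f i))\<^sup>2))"
    by (simp only: inner_prod_def)
  let ?g = "\<lambda>i. r i * (cmod (f i))\<^sup>2"
  show ?thesis
  proof (cases "?g summable_on UNIV")
    case True
    then have "((\<lambda>i. complex_of_real (?g i)) has_sum complex_of_real (infsum ?g UNIV)) UNIV"
      by (intro has_sum_of_real has_sum_infsum)
    moreover have "0 \<le> infsum ?g UNIV" using assms by (intro infsum_nonneg) auto
    ultimately show ?thesis unfolding eq by (auto dest: infsumI)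
  next
    case False
    then have "\<not> (\<lambda>i. complex_of_real (?g i)) summable_on UNIV"
      using summable_on_Re[of "\<lambda>i. complex_of_real (?g i)" UNIV] by auto
    then show ?thesis unfolding eq by (simp add: infsum_not_exists)
  qed
qed

text \<open>The absolute value of a diagonal operator is the diagonal operator of the absolute values, so
  absolute summability of the diagonal makes it trace class.\<close>

lemma op_trace_diagonal:
  assumes summ: "(\<lambda>i. cmod (d i)) summable_on UNIV"
  shows "op_trace (\<lambda>f i. d i * f i) = infsum d UNIV"
proof -
  have bound: "cmod (d i) \<le> infsum (\<lambda>i. cmod (d i)) UNIV" for i
    using finite_sum_le_infsum[OF summ, of "{i}"] by simp
  let ?S = "\<lambda>f i. complex_of_real (cmod (d i)) * f i"
  have ket: "inner_prod (ket m n) (\<lambda>i. e i * ket m n i) = e (m, n)" for e m n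
    by (simp add: inner_prod_ket) (simp add: ket_def)
  have abs: "cnj (complex_of_real (cmod z) * v) * (complex_of_real (cmod z) * w) = cnj (z * v) * (z * w)"
    for z v w :: complex
  proof -
    have "complex_of_real (cmod z) * complex_of_real (cmod z) = cnj z * z"
      using complex_norm_square[of z] by (simp add: power2_eq_square mult.commute)
    then have "(complex_of_real (cmod z) * complex_of_real (cmod z)) * (cnj v * w) = (cnj z * z) * (cnj v * w)"
      by simp
    then show ?thesis by (simp add: mult_ac)
  qed
  have "is_abs_op (\<lambda>f i. d i * f i) ?S"
    unfolding is_abs_op_def inner_prod_def[of "\<lambda>i. _ i * _ i"] abs
    using bounded_op_diagonal[of "\<lambda>i. complex_of_real (cmod (d i))"] bound
      inner_prod_diagonal_nonneg[of "\<lambda>i. cmod (d i)"]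
    by auto
  moreover have "(\<lambda>(m, n). inner_prod (ket m n) (?S (ket m n))) summable_on UNIV"
    using summable_on_of_real[OF summ, where 'a = complex] by (simp add: ket case_prod_unfold)
  ultimately have "trace_class (\<lambda>f i. d i * f i)"
    using bounded_op_diagonal[OF bound] by (auto simp: trace_class_def)
  then show ?thesis
    by (simp add: op_trace_def ket case_prod_unfold)
qed

section \<open>The pairing\<close>

definition proj_trace :: "real \<Rightarrow> free_alg" where
  "proj_trace q = (\<Sum>i<4. proj_entries q ! i ! i)"

lemma ch0_qproj: "ch0 q (qproj q) = cls q (proj_trace q)"
  by (simp add: ch0_def qproj_def proj_trace_def cls_sum)

text \<open>The matrix trace of \<open>p\<close> is \<open>2\<close> plus a multiple of \<open>t\<close>, and \<open>\<sigma>(t)\<close> is diagonal while \<open>\<beta>(t) = 0\<close>.\<close>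

lemma proj_trace_sigma_beta:
  "free_rep q (proj_trace q) f i - free_char (proj_trace q) * f i =
    complex_of_real ((q powi (-2) + 1 - q powi (-4) - q powi 2) * q ^ (2 * fst i + 4 * snd i + 4)) * f i"
proof -
  have eq: "proj_trace q = qpow q (-2) * letter Gt + letter Gt + (1 - qpow q (-4) * letter Gt)
      + (1 - qpow q 2 * letter Gt)"
    by (simp add: proj_trace_def proj_entries_def Let_def eval_nat_numeral)
  have "free_char 1 = 1" using free_char_word[of "[]" 1]
    by (simp add: one_scal scal_def zero_word_def)
  then show ?thesis
    unfolding eq by (cases i) (simp add: fr free_char_add free_char_diff free_char_mult free_char_letter algebra_simps)
qed

text \<open>The coefficient of \<open>t\<close> factors as \<open>- q\<^sup>-\<^sup>4 (1 - q\<^sup>2) (1 - q\<^sup>4)\<close>, which cancels the double geometric series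
  exactly.\<close>

lemma has_sum_proj_trace:
  fixes q :: real
  assumes "0 < \<bar>q\<bar>" "\<bar>q\<bar> < 1"
  shows "((\<lambda>i. (q powi (-2) + 1 - q powi (-4) - q powi 2) * q ^ (2 * fst i + 4 * snd i + 4)) has_sum -1) UNIV"
proof -
  have q: "q \<noteq> 0" "0 < 1 - q\<^sup>2" "0 < 1 - q ^ 4"
    using assms power_less_one_iff[of "\<bar>q\<bar>" 2] power_less_one_iff[of "\<bar>q\<bar>" 4]
    by (auto simp: power_even_abs)
  have c: "(q powi (-2) + 1 - q powi (-4) - q powi 2) * q ^ 4 = - ((1 - q\<^sup>2) * (1 - q ^ 4))"
    using q(1) by (simp add: power_int_minus field_simps)
  have "((\<lambda>(m, n). (q\<^sup>2) ^ m * (q ^ 4) ^ n) has_sum (1 / ((1 - q\<^sup>2) * (1 - q ^ 4)))) UNIV"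
    using q by (intro has_sum_geometric_pair) auto
  from has_sum_cmult_right[OF this, of "- ((1 - q\<^sup>2) * (1 - q ^ 4))"]
  have "((\<lambda>i. - ((1 - q\<^sup>2) * (1 - q ^ 4)) * ((q\<^sup>2) ^ fst i * (q ^ 4) ^ snd i)) has_sum -1) UNIV"
    using q by (simp add: case_prod_beta)
  moreover have "- ((1 - q\<^sup>2) * (1 - q ^ 4)) * ((q\<^sup>2) ^ fst i * (q ^ 4) ^ snd i) =
      (q powi (-2) + 1 - q powi (-4) - q powi 2) * q ^ (2 * fst i + 4 * snd i + 4)" for i :: "nat \<times> nat"
    unfolding c [symmetric] by (simp add: power_add power_mult)
  ultimately show ?thesis by simp
qed

lemma infsum_proj_trace:
  fixes q :: real
  assumes "0 < \<bar>q\<bar>" "\<bar>q\<bar> < 1"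
  shows "(\<Sum>\<^sub>\<infinity>i. complex_of_real ((q powi (-2) + 1 - q powi (-4) - q powi 2)
    * q ^ (2 * fst i + 4 * snd i + 4))) = -1"
  using has_sum_of_real[OF has_sum_proj_trace[OF assms], where 'a = complex] by (auto dest: infsumI)

lemma chern_pairing_qproj:
  assumes q: "0 < \<bar>q\<bar>" "\<bar>q\<bar> < 1"
  shows "chern_pairing q (qproj q) = -1"
proof -
  let ?d = "\<lambda>i. (q powi (-2) + 1 - q powi (-4) - q powi 2) * q ^ (2 * fst i + 4 * snd i + 4)"
  have "?d summable_on UNIV" using has_sum_proj_trace[OF q] by (auto simp: summable_on_def)
  then have "(\<lambda>i. cmod (complex_of_real (?d i))) summable_on UNIV"
    using summable_on_iff_abs_summable_on_real[of ?d UNIV] by (simp only: norm_of_real real_norm_def)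
  from op_trace_diagonal[OF this] show ?thesis
    unfolding chern_pairing_def ch0_qproj tau1_eq sigma_cls[OF q] beta_cls proj_trace_sigma_beta
      infsum_proj_trace[OF q] .
qed

lemma reg_trace_proj_trace:
  assumes q: "0 < \<bar>q\<bar>" "\<bar>q\<bar> < 1"
  shows "reg_trace q (proj_trace q) = -1"
proof -
  let ?d = "\<lambda>i. (q powi (-2) + 1 - q powi (-4) - q powi 2) * q ^ (2 * fst i + 4 * snd i + 4)"
  have "diag_entry q (proj_trace q) i = complex_of_real (?d i)" for i
    using proj_trace_sigma_beta[of q "ket (fst i) (snd i)" i]
    by (simp add: diag_entry_def ket_def)
  then have "reg_trace q (proj_trace q) = (\<Sum>\<^sub>\<infinity>i. complex_of_real (?d i))"
    unfolding reg_trace_def by (intro infsum_cong)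
  with infsum_proj_trace[OF q] show ?thesis by (simp only:)
qed

lemma idempotent_qproj:
  assumes q: "q \<noteq> 0"
  shows "idempotent_module (qsphere q) {..<4} (qproj q)"
proof -
  interpret ring "qsphere q" by (rule ring_qsphere)
  show ?thesis
  proof unfold_locales
    fix i k :: nat assume "i \<in> {..<4}" "k \<in> {..<4}"
    then show "(\<Oplus>\<^bsub>qsphere q\<^esub>j\<in>{..<4}. qproj q i j \<otimes>\<^bsub>qsphere q\<^esub> qproj q j k) = qproj q i k"
      using cls_eqI[OF proj_entries_idempotent[OF q, of i k]]
      by (simp add: qproj_def cls_mult [symmetric] cls_sum)
  qed (simp_all add: qproj_def cls_closed)
qed

theorem mainTheorem9:
  fixes q :: real
  assumes "0 < \<bar>q\<bar>" and "\<bar>q\<bar> < 1"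
  shows "chern_pairing q (qproj q) = -1 \<and> \<not> free_module (qsphere q) (proj_module q)"
proof
  show "chern_pairing q (qproj q) = -1" using assms by (rule chern_pairing_qproj)
  show "\<not> free_module (qsphere q) (proj_module q)"
  proof
    assume "free_module (qsphere q) (proj_module q)"
    then have free: "free_module (qsphere q) (matrix_image (qsphere q) {..<4} (qproj q))"
      by (simp add: proj_module_matrix_image)
    \<comment> \<open>\<open>\<tau>\<^sup>1\<close> by its matrix coefficients, for which additivity and the trace property are available.\<close>
    define tau where "tau c = (\<Sum>\<^sub>\<infinity>i. sigma q c (ket (fst i) (snd i)) i - beta c)" for c
    have tau_cls: "tau (cls q x) = reg_trace q x" for x
      by (simp add: tau_def sigma_cls[OF assms] beta_cls reg_trace_def diag_entry_def)
    interpret idempotent_module "qsphere q" "{..<4}" "qproj q"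
      "matrix_image (qsphere q) {..<4} (qproj q)"
      using assms idempotent_qproj[of q] by simp_all
    have "\<exists>n::nat. tau (\<Oplus>\<^bsub>qsphere q\<^esub>i\<in>{..<4}. qproj q i i) = of_nat n * tau \<one>\<^bsub>qsphere q\<^esub>"
    proof (rule trace_of_free[OF free])
      fix c c' assume "c \<in> carrier (qsphere q)" "c' \<in> carrier (qsphere q)"
      then obtain x y where "c = cls q x" "c' = cls q y" using carrier_qsphere by blast
      then show "tau (c \<oplus>\<^bsub>qsphere q\<^esub> c') = tau c + tau c'"
        and "tau (c \<otimes>\<^bsub>qsphere q\<^esub> c') = tau (c' \<otimes>\<^bsub>qsphere q\<^esub> c)"
        using reg_trace_add[OF assms(2), of x y] reg_trace_commute[OF assms(2), of x y]
        by (simp_all add: tau_cls flip: cls_add cls_mult)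
    qed
    moreover have "tau (\<Oplus>\<^bsub>qsphere q\<^esub>i\<in>{..<4}. qproj q i i) = -1"
      using ch0_qproj[of q] reg_trace_proj_trace[OF assms] by (simp add: ch0_def tau_cls)
    moreover have "tau \<one>\<^bsub>qsphere q\<^esub> = 0"
      by (simp add: tau_cls reg_trace_one flip: cls_one)
    ultimately show False by simp
  qed
qed

end
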